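(* If $\sigma$ is a permutation of $[n]=\{1,\dots,n\}$ whose cycles have lengths $l_1,\dots,l_m$, then the normalized volume of the slice $\Pi_n^\sigma$ of the permutahedron $\Pi_n$ fixed by $\sigma$ is $$\mathrm{Vol}\,\Pi_n^\sigma = n^{m-2}\gcd(l_1,\dots,l_m).$$
   Context: The permutahedron is $\Pi_n=\mathrm{conv}\{(\pi(1),\dots,\pi(n)) : \pi\in S_n\}\subset\mathbb{R}^n$. The symmetric group $S_n$ acts on $\Pi_n\subset\mathbb{R}^n$ by $\sigma\cdot x=(x_{\sigma^{-1}(1)},\dots,x_{\sigma^{-1}(n)})$. The slice of $\Pi_n$ fixed by $\sigma$ is $\Pi_n^\sigma=\{x\in\Pi_n : \sigma\cdot x=x\}$. Fixed points of $\sigma$ count as cycles of length $1$, so $l_1+\cdots+l_m=n$. Normalized volume: volumes are normalized so that every primitive parallelotope has volume $1$. Precisely, let $P$ be a $d$-dimensional polytope on an affine $d$-plane $L\subset\mathbb{R}^n$. Assume $L$ is integral, in the sense that $L\cap\mathbb{Z}^n$ is a lattice translate of a $d$-dimensional lattice $\Lambda$. A lattice $d$-parallelotope in $L$ is called primitive if its edges generate the lattice $\Lambda$; all primitive parallelotopes have the same volume. Then $\mathrm{Vol}(P):=\mathrm{EVol}(P)/\mathrm{EVol}(\square)$ for any primitive parallelotope $\square$ in $L$, where $\mathrm{EVol}$ denotes Euclidean volume. By convention, the normalized volume of a point is $1$. The definition makes sense even when $P$ is not an integral polytope. *)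

theory Defs
  imports
    "HOL-Analysis.Analysis"
    "HOL-Combinatorics.Orbits"
    "HOL-Computational_Algebra.Group_Closure"
begin

section \<open>The permutahedron and its slices\<close>

text \<open>
  The coordinates of \<open>\<real>\<^sup>n\<close> are indexed by a finite type with \<open>n\<close> elements, which plays the role of
  \<open>[n]\<close> and carries no order. The vertices of the permutahedron are therefore given by the
  bijections from the index type to \<open>{1..n}\<close>, and elements of \<open>S\<^sub>n\<close> are the permutations of the
  index type.
\<close>

definition permutahedron :: "(real ^ 'n) set" where
  "permutahedron =
     convex hull {(\<chi> i. real (\<pi> i)) |\<pi>. bij_betw \<pi> (UNIV :: 'n set) {1..CARD('n)}}"

definition perm_act :: "('n \<Rightarrow> 'n) \<Rightarrow> real ^ 'n \<Rightarrow> real ^ 'n" where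
  "perm_act \<sigma> x = (\<chi> i. x $ (inv \<sigma> i))"

definition permutahedron_slice :: "('n \<Rightarrow> 'n) \<Rightarrow> (real ^ 'n) set" where
  "permutahedron_slice \<sigma> = {x \<in> permutahedron. perm_act \<sigma> x = x}"

text \<open>Each cycle contributes its length once; fixed points are cycles of length 1.\<close>

definition cycle_lengths :: "('n::finite \<Rightarrow> 'n) \<Rightarrow> nat multiset" where
  "cycle_lengths \<sigma> = image_mset card (mset_set (range (orbit \<sigma>)))"


section \<open>Normalized volume\<close>

definition direction_space :: "'a::real_vector set \<Rightarrow> 'a set" where
  "direction_space L = {x - y |x y. x \<in> L \<and> y \<in> L}"

definition orthonormal_basis_of :: "'a::euclidean_space set \<Rightarrow> 'a set \<Rightarrow> bool" where
  "orthonormal_basis_of V B \<longleftrightarrow> pairwise orthogonal B \<and> (\<forall>b\<in>B. norm b = 1) \<and> span B = V"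

text \<open>
  The \<open>d\<close>-dimensional Euclidean volume of a set of dimension \<open>d\<close>: the Lebesgue measure of the set in
  Cartesian coordinates on its affine hull. It does not depend on the chosen origin \<open>p\<close> and
  orthonormal basis \<open>B\<close>.
\<close>

definition euclidean_volume :: "'a::euclidean_space set \<Rightarrow> real" where
  "euclidean_volume P =
     (let L = affine hull P;
          p = (SOME p. p \<in> L);
          B = (SOME B. orthonormal_basis_of (direction_space L) B)
      in measure (\<Pi>\<^sub>M b\<in>B. lborel) {c \<in> B \<rightarrow>\<^sub>E UNIV. p + (\<Sum>b\<in>B. c b *\<^sub>R b) \<in> P})"

definition integer_points :: "(real ^ 'n) set" where
  "integer_points = {x. \<forall>i. x $ i \<in> \<int>}"

text \<open>
  If \<open>L\<close> contains an integer point, then its integer points form a translate of this lattice. The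
  lattice also makes sense if \<open>L\<close> contains none. This matters for the permutahedron: for \<open>n = 6\<close>
  and two cycles of lengths 2 and 4, the affine hull of the slice has the equation
  \<open>2 * a + 4 * b = 21\<close>.
\<close>

definition direction_lattice :: "(real ^ 'n) set \<Rightarrow> (real ^ 'n) set" where
  "direction_lattice L = direction_space L \<inter> integer_points"

text \<open>
  The edge vectors \<open>B\<close> at the vertex \<open>p\<close> form a basis of the lattice. The vertex is an integer point
  whenever \<open>L\<close> has one, so that the parallelotope is then a lattice parallelotope; its volume does
  not depend on \<open>p\<close>.
\<close>

definition primitive_parallelotope :: "(real ^ 'n) set \<Rightarrow> (real ^ 'n) set \<Rightarrow> bool" where
  "primitive_parallelotope L Q \<longleftrightarrow>
     (\<exists>p B. p \<in> L \<and> (L \<inter> integer_points \<noteq> {} \<longrightarrow> p \<in> integer_points) \<and>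
        independent B \<and> int (card B) = aff_dim L \<and> group_closure B = direction_lattice L \<and>
        Q = {p + (\<Sum>b\<in>B. t b *\<^sub>R b) |t. \<forall>b\<in>B. 0 \<le> t b \<and> t b \<le> 1})"

text \<open>All primitive parallelotopes in \<open>L\<close> have the same Euclidean volume.\<close>

definition normalized_volume :: "(real ^ 'n) set \<Rightarrow> real" where
  "normalized_volume P =
     euclidean_volume P / euclidean_volume (SOME Q. primitive_parallelotope (affine hull P) Q)"

text \<open>The convention that a point has normalized volume 1 is a consequence of the definitions.\<close>

lemma euclidean_volume_point: "euclidean_volume {x} = 1"
proof -
  have V: "direction_space {x} = {0}"
    by (auto simp: direction_space_def)
  have onb: "orthonormal_basis_of {0} B \<longleftrightarrow> B = {}" for B :: "'a set"
  proof
    assume *: "orthonormal_basis_of {0} B"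
    then have "B \<subseteq> {0}"
      using span_superset unfolding orthonormal_basis_of_def by blast
    with * show "B = {}"
      unfolding orthonormal_basis_of_def by fastforce
  qed (simp add: orthonormal_basis_of_def)
  then have "(SOME B. orthonormal_basis_of (direction_space {x}) B) = {}"
    by (simp only: V some_eq_trivial)
  moreover have "{c \<in> {} \<rightarrow>\<^sub>E (UNIV :: real set). x + (\<Sum>b\<in>{}. c b *\<^sub>R b) \<in> {x}} = {\<lambda>_. undefined}"
    by auto
  ultimately show ?thesis
    by (simp add: euclidean_volume_def PiM_empty measure_def)
qed

lemma normalized_volume_point: "normalized_volume {x} = 1"
proof -
  have "direction_lattice {x} = {0}"
    by (auto simp: direction_lattice_def direction_space_def integer_points_def)
  then have "primitive_parallelotope {x} {x}"
    unfolding primitive_parallelotope_def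
    by (intro exI[of _ x] exI[of _ "{}"]) (simp add: independent_empty)
  then have ex: "\<exists>Q. primitive_parallelotope {x} Q" ..
  have "Q = {x}" if "primitive_parallelotope {x} Q" for Q
  proof -
    from that obtain B where B: "independent B" "card B = 0"
      and Q: "Q = {x + (\<Sum>b\<in>B. t b *\<^sub>R b) |t. \<forall>b\<in>B. 0 \<le> t b \<and> t b \<le> 1}"
      unfolding primitive_parallelotope_def by (elim exE conjE) simp
    from B have "B = {}"
      by (simp add: independent_imp_finite)
    with Q show ?thesis by simp
  qed
  with someI_ex[OF ex] have "(SOME Q. primitive_parallelotope {x} Q) = {x}"
    by blast
  then show ?thesis
    by (simp add: normalized_volume_def euclidean_volume_point)
qed

end

(*
  The permutahedron is a translate of the Voronoi cell of the lattice of all n u - (sum u) 1 with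
  u in Z^n. Its slice fixed by sigma is a translate of the Voronoi cell W of the lattice M obtained
  from the sigma-fixed u, inside the (m-1)-dimensional space E of sigma-fixed vectors with
  coordinate sum 0. For Lambda = E cap Z^n we have n Lambda <= M <= Lambda, and the residue of sum u
  modulo n identifies M / n Lambda with gZ / nZ, where g is the gcd of the cycle lengths. A Voronoi
  cell tiles space by translations, and so does a primitive parallelotope of Lambda. Comparing both
  tilings modulo n Lambda gives (n/g) vol W = n^(m-1) vol(parallelotope).
*)
theory Submission
  imports Defs
begin

section \<open>Euclidean measure on subspaces\<close>

text \<open>Cutting the Voronoi cell of a lattice with a subspace can give less than the Voronoi
  cell of the sublattice lying there, since the sublattice imposes fewer inequalities. That nothing
  is lost here is the main geometric point. The centred permutahedron has as support function one
  quarter of the sum of \<open>\<bar>a $ i - a $ j\<bar>\<close> over all ordered pairs, and the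
  Voronoi inequality of the lattice vector of \<open>u\<close> has the same right-hand side with
  squares in place of absolute values. For integers the absolute value is at most the square, with
  equality for 0/1 vectors, and every functional decomposes into 0/1 vectors along its level sets. A
  fixed point outside the permutahedron is separated from it by a fixed functional. Its level sets
  are unions of cycles, so the 0/1 vectors are fixed too and the inequalities of the sublattice
  suffice. On the measure side, the basis picked in \<open>euclidean_volume\<close> depends on the
  direction space only, so slice and parallelotope are measured by the same measure and their
  quotient compares two tiles.\<close>

definition span_measure :: "'a::euclidean_space set \<Rightarrow> 'a measure" where
  "span_measure B = distr (\<Pi>\<^sub>M b\<in>B. lborel) borel (\<lambda>c. \<Sum>b\<in>B. c b *\<^sub>R b)"

lemma sets_span_measure [simp, measurable_cong]: "sets (span_measure B) = sets borel"
  by (simp add: span_measure_def)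

lemma space_span_measure [simp]: "space (span_measure B) = UNIV"
  by (simp add: span_measure_def)

lemma measurable_span_coords [measurable]:
  "(\<lambda>c. \<Sum>b\<in>B. c b *\<^sub>R b) \<in> (\<Pi>\<^sub>M b\<in>B. lborel) \<rightarrow>\<^sub>M (borel :: 'a::euclidean_space measure)"
  by measurable

lemma emeasure_span_measure:
  assumes "X \<in> sets borel"
  shows "emeasure (span_measure B) X =
    emeasure (\<Pi>\<^sub>M b\<in>B. lborel) {c \<in> B \<rightarrow>\<^sub>E UNIV. (\<Sum>b\<in>B. c b *\<^sub>R b) \<in> X}"
  unfolding span_measure_def
  by (subst emeasure_distr) (use assms in \<open>auto simp: space_PiM vimage_def Int_def conj_commute\<close>)

interpretation lborel_product: product_sigma_finite "\<lambda>_. lborel"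
  by standard

lemma emeasure_lborel_affine_vimage:
  fixes t :: real
  assumes "t \<noteq> 0" "A \<in> sets borel"
  shows "emeasure lborel A = ennreal \<bar>t\<bar> * emeasure lborel ((\<lambda>x. s + t * x) -` A)"
proof -
  have "emeasure lborel A =
      emeasure (density (distr lborel borel (\<lambda>x. s + t * x)) (\<lambda>_. ennreal \<bar>t\<bar>)) A"
    using lborel_real_affine[OF assms(1)] by metis
  also have "\<dots> = ennreal \<bar>t\<bar> * emeasure lborel ((\<lambda>x. s + t * x) -` A)"
    using assms(2) by (subst emeasure_density) (auto simp: nn_integral_cmult emeasure_distr)
  finally show ?thesis .
qed

text \<open>Product measures are determined by boxes. The map acts coordinate by coordinate, so each
  of the \<open>card B\<close> factors contributes one \<open>\<bar>t\<bar>\<close>.\<close>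

lemma emeasure_PiM_lborel_affine_vimage:
  fixes t :: real
  assumes "finite B" "t \<noteq> 0" "X \<in> sets (\<Pi>\<^sub>M b\<in>B. lborel)"
  shows "emeasure (\<Pi>\<^sub>M b\<in>B. lborel) X = ennreal (\<bar>t\<bar> ^ card B) *
    emeasure (\<Pi>\<^sub>M b\<in>B. lborel) {c \<in> B \<rightarrow>\<^sub>E UNIV. (\<lambda>b\<in>B. s b + t * c b) \<in> X}"
proof -
  let ?M = "\<Pi>\<^sub>M b\<in>B. (lborel :: real measure)"
  let ?\<phi> = "\<lambda>c. \<lambda>b\<in>B. s b + t * c b"
  have meas: "?\<phi> \<in> ?M \<rightarrow>\<^sub>M ?M"
    by measurable
  have pre: "?\<phi> -` Y \<inter> space ?M = {c \<in> B \<rightarrow>\<^sub>E UNIV. ?\<phi> c \<in> Y}" for Y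
    by (auto simp: space_PiM)
  have "scale_measure (ennreal (\<bar>t\<bar> ^ card B)) (distr ?M ?M ?\<phi>) = ?M"
  proof (rule lborel_product.PiM_eqI)
    fix A :: "'a \<Rightarrow> real set" assume A: "\<And>b. b \<in> B \<Longrightarrow> A b \<in> sets lborel"
    then have PA: "Pi\<^sub>E B A \<in> sets ?M"
      using \<open>finite B\<close> by (intro sets_PiM_I_finite) auto
    have pre': "(\<lambda>x. s b + t * x) -` A b \<in> sets lborel" if "b \<in> B" for b
      using measurable_sets[of "\<lambda>x. s b + t * x" lborel lborel "A b"] A[OF that] by simp
    have box: "?\<phi> -` Pi\<^sub>E B A \<inter> space ?M = Pi\<^sub>E B (\<lambda>b. (\<lambda>x. s b + t * x) -` A b)"
      by (fastforce simp: space_PiM PiE_def Pi_def extensional_def)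
    have "emeasure (scale_measure (ennreal (\<bar>t\<bar> ^ card B)) (distr ?M ?M ?\<phi>)) (Pi\<^sub>E B A) =
        ennreal (\<bar>t\<bar> ^ card B) * (\<Prod>b\<in>B. emeasure lborel ((\<lambda>x. s b + t * x) -` A b))"
      using pre' \<open>finite B\<close> unfolding emeasure_scale_measure
      by (simp only: emeasure_distr[OF meas PA] box lborel_product.emeasure_PiM)
    also have "\<dots> = (\<Prod>b\<in>B. ennreal \<bar>t\<bar> * emeasure lborel ((\<lambda>x. s b + t * x) -` A b))"
      by (simp add: prod.distrib ennreal_power)
    also have "\<dots> = (\<Prod>b\<in>B. emeasure lborel (A b))"
      using A by (intro prod.cong refl emeasure_lborel_affine_vimage[OF \<open>t \<noteq> 0\<close>, symmetric]) auto
    finally show "emeasure (scale_measure (ennreal (\<bar>t\<bar> ^ card B)) (distr ?M ?M ?\<phi>)) (Pi\<^sub>E B A) =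
        (\<Prod>b\<in>B. emeasure lborel (A b))" .
  qed (use assms in auto)
  then have "emeasure ?M X = emeasure (scale_measure (ennreal (\<bar>t\<bar> ^ card B)) (distr ?M ?M ?\<phi>)) X"
    by simp
  also have "\<dots> = ennreal (\<bar>t\<bar> ^ card B) * emeasure ?M {c \<in> B \<rightarrow>\<^sub>E UNIV. ?\<phi> c \<in> X}"
    unfolding emeasure_scale_measure by (simp only: emeasure_distr[OF meas assms(3)] pre)
  finally show ?thesis .
qed

lemma borel_affine_image:
  fixes t :: real and v :: "'a::euclidean_space"
  assumes "t \<noteq> 0" "S \<in> sets borel"
  shows "(\<lambda>x. v + t *\<^sub>R x) ` S \<in> sets borel"
proof -
  have "(\<lambda>x. v + t *\<^sub>R x) ` S = (\<lambda>x. (x - v) /\<^sub>R t) -` S \<inter> space borel"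
    using assms(1) by (auto simp: image_iff intro!: bexI[of _ "(_ - v) /\<^sub>R t"])
  also have "\<dots> \<in> sets borel"
    using assms(2) by (intro measurable_sets[of _ borel borel]) auto
  finally show ?thesis .
qed

text \<open>\<open>span_measure B\<close> lives on \<open>span B\<close>, so the shift has to stay
  in that span. In coordinates it is then a shift by the coefficients of \<open>v\<close>, and
  \<open>emeasure_PiM_lborel_affine_vimage\<close> applies.\<close>

lemma emeasure_span_measure_affine:
  fixes t :: real and v :: "'a::euclidean_space"
  assumes "finite B" "v \<in> span B" "t \<noteq> 0" "S \<in> sets borel"
  shows "emeasure (span_measure B) ((\<lambda>x. v + t *\<^sub>R x) ` S) =
    ennreal (\<bar>t\<bar> ^ card B) * emeasure (span_measure B) S"
proof -
  let ?M = "\<Pi>\<^sub>M b\<in>B. (lborel :: real measure)"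
  let ?S = "(\<lambda>x. v + t *\<^sub>R x) ` S"
  obtain s where s: "v = (\<Sum>b\<in>B. s b *\<^sub>R b)"
    using assms(1,2) by (auto simp: span_finite)
  let ?X = "{c \<in> B \<rightarrow>\<^sub>E UNIV. (\<Sum>b\<in>B. c b *\<^sub>R b) \<in> ?S}"
  have S: "?S \<in> sets borel"
    by (rule borel_affine_image) fact+
  have "?X = (\<lambda>c. \<Sum>b\<in>B. c b *\<^sub>R b) -` ?S \<inter> space ?M"
    by (auto simp: space_PiM)
  also have "\<dots> \<in> sets ?M"
    using S by (intro measurable_sets[OF measurable_span_coords])
  finally have X: "?X \<in> sets ?M" .
  have lin: "(\<Sum>b\<in>B. (\<lambda>b\<in>B. s b + t * c b) b *\<^sub>R b) = v + t *\<^sub>R (\<Sum>b\<in>B. c b *\<^sub>R b)" for c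
    by (simp add: s scaleR_add_left sum.distrib scaleR_sum_right)
  have mem: "v + t *\<^sub>R y \<in> ?S \<longleftrightarrow> y \<in> S" for y
    using assms(3) by auto
  have "{c \<in> B \<rightarrow>\<^sub>E UNIV. (\<lambda>b\<in>B. s b + t * c b) \<in> ?X} = {c \<in> B \<rightarrow>\<^sub>E UNIV. (\<Sum>b\<in>B. c b *\<^sub>R b) \<in> S}"
    unfolding mem_Collect_eq lin mem by auto
  then show ?thesis
    using emeasure_PiM_lborel_affine_vimage[OF assms(1,3) X, of s]
    by (simp only: emeasure_span_measure[OF S] emeasure_span_measure[OF assms(4)])
qed

lemma measure_span_measure_affine:
  fixes t :: real
  assumes "finite B" "v \<in> span B" "t \<noteq> 0" "S \<in> sets borel"
  shows "measure (span_measure B) ((\<lambda>x. v + t *\<^sub>R x) ` S) = \<bar>t\<bar> ^ card B * measure (span_measure B) S"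
  using emeasure_span_measure_affine[OF assms]
  by (simp add: measure_def enn2real_mult)

lemma measure_span_measure_translate:
  assumes "finite B" "v \<in> span B" "S \<in> sets borel"
  shows "measure (span_measure B) ((+) v ` S) = measure (span_measure B) S"
  using measure_span_measure_affine[OF assms(1,2) _ assms(3), of 1] by simp

lemma measure_span_measure_scaleR:
  fixes t :: real
  assumes "finite B" "t > 0" "S \<in> sets borel"
  shows "measure (span_measure B) ((*\<^sub>R) t ` S) = t ^ card B * measure (span_measure B) S"
  using measure_span_measure_affine[OF assms(1) span_zero _ assms(3), of t] assms(2) by simp

lemma orthonormal_coordinate:
  assumes "orthonormal_basis_of V B" "finite B" "a \<in> B"
  shows "(\<Sum>b\<in>B. c b *\<^sub>R b) \<bullet> a = c a"
proof -
  have "(\<Sum>b\<in>B. c b *\<^sub>R b) \<bullet> a = (\<Sum>b\<in>B. c b * (b \<bullet> a))"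
    by (simp add: inner_sum_left)
  also have "\<dots> = (\<Sum>b\<in>B. if b = a then c a else 0)"
    using assms by (intro sum.cong)
      (auto simp: orthonormal_basis_of_def pairwise_def orthogonal_def norm_eq_1)
  also have "\<dots> = c a"
    using assms by simp
  finally show ?thesis .
qed

lemma orthonormal_basis_of_independent:
  assumes "orthonormal_basis_of V B"
  shows "independent B"
  using assms unfolding orthonormal_basis_of_def
  by (intro pairwise_orthogonal_independent) auto

text \<open>Orthonormality bounds every coordinate by the norm, so the coordinates of
  \<open>S\<close> lie in a cube. Finiteness is what later permits passing between
  \<open>emeasure\<close> and \<open>measure\<close>.\<close>

lemma emeasure_span_measure_finite:
  assumes "orthonormal_basis_of V B" "bounded S" "S \<in> sets borel"
  shows "emeasure (span_measure B) S < \<infinity>"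
proof -
  have fin: "finite B"
    using orthonormal_basis_of_independent[OF assms(1)] independent_imp_finite by blast
  obtain r where r: "\<And>x. x \<in> S \<Longrightarrow> norm x \<le> r"
    using assms(2) by (auto simp: bounded_iff)
  have "{c \<in> B \<rightarrow>\<^sub>E UNIV. (\<Sum>b\<in>B. c b *\<^sub>R b) \<in> S} \<subseteq> (\<Pi>\<^sub>E b\<in>B. {-r..r})"
  proof (intro subsetI PiE_I; clarsimp)
    fix c b assume c: "(\<Sum>b\<in>B. c b *\<^sub>R b) \<in> S" and b: "b \<in> B"
    have "\<bar>c b\<bar> = \<bar>(\<Sum>b\<in>B. c b *\<^sub>R b) \<bullet> b\<bar>"
      using orthonormal_coordinate[OF assms(1) fin b] by simp
    also have "\<dots> \<le> norm (\<Sum>b\<in>B. c b *\<^sub>R b) * norm b"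
      by (rule Cauchy_Schwarz_ineq2)
    also have "\<dots> \<le> r"
      using r[OF c] b assms(1) by (simp add: orthonormal_basis_of_def)
    finally show "- r \<le> c b \<and> c b \<le> r"
      by linarith
  qed (auto simp: PiE_def extensional_def)
  then have "emeasure (span_measure B) S \<le> emeasure (\<Pi>\<^sub>M b\<in>B. lborel) (\<Pi>\<^sub>E b\<in>B. {-r..r})"
    unfolding emeasure_span_measure[OF assms(3)]
    by (intro emeasure_mono sets_PiM_I_finite fin) auto
  also have "\<dots> = (\<Prod>b\<in>B. emeasure lborel {-r..r})"
    by (rule lborel_product.emeasure_PiM[OF fin]) auto
  also have "\<dots> < \<infinity>"
    by (auto simp: emeasure_lborel_Icc_eq power_less_top_ennreal)
  finally show ?thesis .
qed

lemma emeasure_span_measure_span_nonzero: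
  assumes "finite B"
  shows "emeasure (span_measure B) (span B) \<noteq> 0"
proof -
  have "(\<Sum>b\<in>B. c b *\<^sub>R b) \<in> span B" for c
    by (intro span_sum span_scale span_base)
  then have "emeasure (span_measure B) (span B) = emeasure (\<Pi>\<^sub>M b\<in>B. lborel) (\<Pi>\<^sub>E b\<in>B. (UNIV::real set))"
    by (subst emeasure_span_measure) (auto simp: borel_closed closed_span)
  also have "\<dots> = (\<Prod>b\<in>B. emeasure lborel (UNIV::real set))"
    by (rule lborel_product.emeasure_PiM[OF assms]) auto
  also have "\<dots> \<noteq> 0"
    by (simp add: assms)
  finally show ?thesis .
qed

lemma euclidean_volume_eq_span_measure:
  assumes "affine hull P = L" "L \<noteq> {}" "P \<in> sets borel"
  defines "p \<equiv> SOME p. p \<in> L" and "B \<equiv> SOME B. orthonormal_basis_of (direction_space L) B"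
  shows "euclidean_volume P = measure (span_measure B) ((\<lambda>x. x - p) ` P)"
proof -
  have "(\<lambda>x. x - p) ` P \<in> sets borel"
    using borel_affine_image[of 1 P "- p"] assms(3) by simp
  moreover have "y \<in> (\<lambda>x. x - p) ` P \<longleftrightarrow> p + y \<in> P" for y
    by (auto simp: image_iff algebra_simps intro!: bexI[of _ "p + y"])
  ultimately show ?thesis
    unfolding euclidean_volume_def Let_def measure_def assms(1)
    by (simp add: emeasure_span_measure flip: p_def B_def)
qed

lemma affine_hull_translate_span:
  assumes "0 \<in> A"
  shows "affine hull ((+) p ` A) = (+) p ` span A"
  by (simp add: affine_hull_translation affine_hull_span_0[OF hull_inc[OF assms]])

lemma direction_space_translate:
  assumes "subspace E"
  shows "direction_space ((+) p ` E) = E"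
proof (intro equalityI subsetI)
  fix x assume "x \<in> direction_space ((+) p ` E)"
  then show "x \<in> E"
    using subspace_diff[OF assms] by (auto simp: direction_space_def)
next
  fix x assume "x \<in> E"
  moreover have "x = (p + x) - (p + 0)"
    by simp
  ultimately show "x \<in> direction_space ((+) p ` E)"
    unfolding direction_space_def using subspace_0[OF assms] by blast
qed

lemma ex_orthonormal_basis_of:
  assumes "subspace E"
  shows "\<exists>B. orthonormal_basis_of E B"
proof -
  obtain B where "pairwise orthogonal B" "\<And>x. x \<in> B \<Longrightarrow> norm x = 1" "span B = E"
    using orthonormal_basis_subspace[OF assms] by blast
  then show ?thesis
    unfolding orthonormal_basis_of_def by blast
qed

text \<open>The basis chosen inside \<open>euclidean_volume\<close> depends only on the direction
  space, so all sets spanning a translate of \<open>E\<close> are measured by the same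
  \<open>span_measure B\<close>. The chosen base point lies on \<open>L\<close>, hence differs from
  \<open>p\<close> by a vector of \<open>E\<close>, and translation invariance absorbs the
  difference.\<close>

lemma euclidean_volume_translate:
  fixes A :: "'a::euclidean_space set"
  assumes "subspace E" "compact A" "0 \<in> A" "span A = E" "(+) p ` E = L"
  defines "B \<equiv> SOME B. orthonormal_basis_of E B"
  shows "euclidean_volume ((+) p ` A) = measure (span_measure B) A"
proof -
  have hull: "affine hull ((+) p ` A) = L"
    using assms by (simp add: affine_hull_translate_span)
  have dir: "direction_space L = E"
    using assms direction_space_translate by blast
  have "orthonormal_basis_of E B"
    unfolding B_def using ex_orthonormal_basis_of[OF assms(1)] by (rule someI_ex)
  then have B: "span B = E" "finite B"
    using orthonormal_basis_of_independent independent_imp_finite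
    by (auto simp: orthonormal_basis_of_def)
  have L: "L \<noteq> {}"
    using assms(5) subspace_0[OF assms(1)] by auto
  define q where "q = (SOME q. q \<in> L)"
  have "q \<in> L"
    unfolding q_def some_in_eq by (rule L)
  then have "q \<in> (+) p ` E"
    by (simp only: assms(5))
  then have "q - p \<in> E"
    by (rule imageE) simp
  then have "p - q \<in> span B"
    using span_neg[of "q - p" B] by (simp add: B)
  have "(\<lambda>x. x - q) ` (+) p ` A = (+) (p - q) ` A"
    by (auto simp: image_image algebra_simps)
  then have "euclidean_volume ((+) p ` A) = measure (span_measure B) ((+) (p - q) ` A)"
    using euclidean_volume_eq_span_measure[OF hull L] assms(2)
    by (simp add: dir B_def q_def borel_compact compact_translation)
  also have "\<dots> = measure (span_measure B) A"
    using assms(2) \<open>p - q \<in> span B\<close> by (intro measure_span_measure_translate B borel_compact)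
  finally show ?thesis .
qed

section \<open>Lattice tilings\<close>

definition additive_subgroup :: "'a::ab_group_add set \<Rightarrow> bool" where
  "additive_subgroup G \<longleftrightarrow> 0 \<in> G \<and> (\<forall>x\<in>G. \<forall>y\<in>G. x - y \<in> G)"

lemma additive_subgroup_zero: "additive_subgroup G \<Longrightarrow> 0 \<in> G"
  and additive_subgroup_diff: "additive_subgroup G \<Longrightarrow> x \<in> G \<Longrightarrow> y \<in> G \<Longrightarrow> x - y \<in> G"
  by (simp_all add: additive_subgroup_def)

lemma additive_subgroup_minus: "additive_subgroup G \<Longrightarrow> x \<in> G \<Longrightarrow> - x \<in> G"
  using additive_subgroup_diff[of G 0 x] by (simp add: additive_subgroup_zero)

lemma additive_subgroup_add: "additive_subgroup G \<Longrightarrow> x \<in> G \<Longrightarrow> y \<in> G \<Longrightarrow> x + y \<in> G"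
  using additive_subgroup_diff[of G x "- y"] by (simp add: additive_subgroup_minus)

lemma additive_subgroup_group_closure: "additive_subgroup (group_closure S)"
  by (simp add: additive_subgroup_def group_closure.diff)

lemma group_closure_subset:
  assumes "additive_subgroup G" "S \<subseteq> G"
  shows "group_closure S \<subseteq> G"
proof
  fix x assume "x \<in> group_closure S"
  then show "x \<in> G"
    by induction (use assms in \<open>auto simp: additive_subgroup_def\<close>)
qed

lemma additive_subgroup_scaleR_int:
  fixes x :: "'a::real_vector"
  assumes "additive_subgroup G" "x \<in> G"
  shows "of_int k *\<^sub>R x \<in> G"
proof -
  have nat: "of_nat m *\<^sub>R x \<in> G" for m
    by (induction m)
      (use assms in \<open>auto simp: scaleR_add_left additive_subgroup_add additive_subgroup_zero\<close>)
  show ?thesis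
  proof (cases "k \<ge> 0")
    case True
    then show ?thesis
      using nat[of "nat k"] by simp
  next
    case False
    then show ?thesis
      using additive_subgroup_minus[OF assms(1) nat[of "nat (- k)"]] by simp
  qed
qed

lemma additive_subgroup_scaleR_image:
  fixes G :: "'a::real_vector set"
  assumes "additive_subgroup G"
  shows "additive_subgroup ((*\<^sub>R) c ` G)"
  unfolding additive_subgroup_def
proof (intro conjI ballI)
  show "0 \<in> (*\<^sub>R) c ` G"
    using additive_subgroup_zero[OF assms] by (auto intro!: image_eqI[of _ _ 0])
next
  fix x y assume "x \<in> (*\<^sub>R) c ` G" "y \<in> (*\<^sub>R) c ` G"
  then show "x - y \<in> (*\<^sub>R) c ` G"
    using additive_subgroup_diff[OF assms] by (auto simp flip: scaleR_diff_right)
qed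

text \<open>
  Demanding disjoint translates only for the shrunken copies \<open>t *\<^sub>R A\<close> with \<open>t < 1\<close> avoids having to
  show that the boundary of \<open>A\<close> is a null set.
\<close>

definition tiles :: "'a::euclidean_space set \<Rightarrow> 'a set \<Rightarrow> bool" where
  "tiles A G \<longleftrightarrow> compact A \<and> A \<subseteq> span G \<and> (\<forall>x\<in>span G. \<exists>g\<in>G. x - g \<in> A) \<and>
     (\<forall>t x y. 0 < t \<and> t < 1 \<and> x \<in> A \<and> y \<in> A \<and> t *\<^sub>R (x - y) \<in> G \<longrightarrow> x = y)"

lemma tiles_packing:
  assumes "tiles A G" "0 < t" "t < 1" "x \<in> A" "y \<in> A" "t *\<^sub>R (x - y) \<in> G"
  shows "x = y"
  using assms unfolding tiles_def by blast

lemma tiles_scaleR: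
  assumes "tiles A G" "c \<noteq> 0"
  shows "tiles ((*\<^sub>R) c ` A) ((*\<^sub>R) c ` G)"
proof -
  have span: "span ((*\<^sub>R) c ` G) = (*\<^sub>R) c ` span G"
    by (rule linear_span_image) (rule linear_scaleR)
  show ?thesis
    unfolding tiles_def span
  proof (intro conjI allI impI ballI)
    show "compact ((*\<^sub>R) c ` A)" "(*\<^sub>R) c ` A \<subseteq> (*\<^sub>R) c ` span G"
      using assms by (auto simp: tiles_def compact_scaling)
  next
    fix x assume "x \<in> (*\<^sub>R) c ` span G"
    then obtain y where y: "x = c *\<^sub>R y" "y \<in> span G"
      by auto
    then obtain g where "g \<in> G" "y - g \<in> A"
      using assms(1) by (auto simp: tiles_def)
    then show "\<exists>g\<in>(*\<^sub>R) c ` G. x - g \<in> (*\<^sub>R) c ` A"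
      using y by (auto simp flip: scaleR_diff_right)
  next
    fix t x y assume *: "0 < t \<and> t < 1 \<and> x \<in> (*\<^sub>R) c ` A \<and> y \<in> (*\<^sub>R) c ` A \<and> t *\<^sub>R (x - y) \<in> (*\<^sub>R) c ` G"
    then obtain a b g where ab: "x = c *\<^sub>R a" "y = c *\<^sub>R b" "a \<in> A" "b \<in> A" "g \<in> G"
      and g: "t *\<^sub>R (x - y) = c *\<^sub>R g"
      by auto
    have "c *\<^sub>R (t *\<^sub>R (a - b)) = c *\<^sub>R g"
      using g ab by (simp add: scaleR_diff_right mult.commute)
    then have "t *\<^sub>R (a - b) \<in> G"
      using assms(2) ab by (simp only: scaleR_cancel_left) simp
    then show "x = y"
      using tiles_packing[OF assms(1), of t a b] * ab by simp
  qed
qed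

text \<open>Modulo \<open>G\<close> the set \<open>A\<close> embeds into \<open>C\<close> piece by
  piece: each point of \<open>A\<close> is moved into \<open>C\<close> by an element of
  \<open>G\<close>, and the moved pieces stay disjoint because no two points of \<open>A\<close> are
  congruent modulo \<open>G\<close>.\<close>

lemma packing_le_covering:
  assumes "finite B" "additive_subgroup G" "countable G" "G \<subseteq> span B"
    and A: "A \<in> sets borel" and C: "C \<in> sets borel"
    and cover: "\<And>a. a \<in> A \<Longrightarrow> \<exists>g\<in>G. a - g \<in> C"
    and pack: "\<And>a a'. a \<in> A \<Longrightarrow> a' \<in> A \<Longrightarrow> a - a' \<in> G \<Longrightarrow> a = a'"
  shows "emeasure (span_measure B) A \<le> emeasure (span_measure B) C"
proof -
  let ?\<nu> = "span_measure B"
  \<comment> \<open>Repetitions in this enumeration, unavoidable for finite \<open>G\<close>, do no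
    harm: \<open>disjointed\<close> below assigns each point of \<open>A\<close> to a single
    index.\<close>
  define e where "e = from_nat_into G"
  have eG: "e k \<in> G" for k
    using additive_subgroup_zero[OF assms(2)] unfolding e_def by (intro from_nat_into) auto
  have eSurj: "\<exists>k. g = e k" if "g \<in> G" for g
    using from_nat_into_surj[OF assms(3) that] unfolding e_def by metis
  have transl: "emeasure ?\<nu> ((+) v ` S) = emeasure ?\<nu> S"
    and transl_borel: "(+) v ` S \<in> sets borel" if "v \<in> span B" "S \<in> sets borel" for v S
    using emeasure_span_measure_affine[OF assms(1) that(1) _ that(2), of 1]
      borel_affine_image[OF _ that(2), of 1 v] by auto
  have espan: "e k \<in> span B" "- e k \<in> span B" for k
    using eG assms(4) by (auto intro: span_neg)
  define P where "P k = A \<inter> (+) (e k) ` C" for k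
  have P: "P k \<in> sets borel" for k
    unfolding P_def using A transl_borel[OF espan(1) C] by auto
  define D where "D = disjointed P"
  have D: "D k \<in> sets borel" for k
    using sets.range_disjointed_sets[of P borel] P unfolding D_def by auto
  have DP: "D k \<subseteq> P k" for k
    unfolding D_def by (rule disjointed_subset)
  have disj: "disjoint_family D"
    unfolding D_def by (rule disjoint_family_disjointed)
  have "A = (\<Union>k. P k)"
  proof (intro equalityI subsetI)
    fix a assume "a \<in> A"
    then obtain g where "g \<in> G" "a - g \<in> C"
      using cover by blast
    with \<open>a \<in> A\<close> show "a \<in> (\<Union>k. P k)"
      using eSurj[of g] by (auto simp: P_def intro!: image_eqI[of _ _ "a - g"])
  qed (auto simp: P_def)
  then have A_eq: "A = (\<Union>k. D k)"
    by (simp add: D_def UN_disjointed_eq)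
  define F where "F k = (+) (- e k) ` D k" for k
  have F: "F k \<in> sets borel" for k
    unfolding F_def by (rule transl_borel[OF espan(2) D])
  have "disjoint_family F"
    unfolding disjoint_family_on_def
  proof (intro ballI impI)
    fix j k :: nat assume "j \<noteq> k"
    show "F j \<inter> F k = {}"
    proof (rule ccontr)
      assume "F j \<inter> F k \<noteq> {}"
      then obtain a a' where a: "a \<in> D j" "a' \<in> D k" "- e j + a = - e k + a'"
        by (auto simp: F_def)
      have "a = e j + (- e j + a)"
        by simp
      also have "\<dots> = e j - e k + a'"
        by (simp only: a) simp
      finally have "a - a' = e j - e k"
        by simp
      then have "a - a' \<in> G"
        using eG additive_subgroup_diff[OF assms(2)] by simp
      moreover have "a \<in> A" "a' \<in> A"
        using a A_eq by auto
      ultimately have "a = a'"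
        using pack by blast
      then show False
        using disj a \<open>j \<noteq> k\<close> unfolding disjoint_family_on_def by blast
    qed
  qed
  have "emeasure ?\<nu> A = (\<Sum>k. emeasure ?\<nu> (D k))"
    unfolding A_eq by (rule suminf_emeasure[symmetric]) (use D disj in auto)
  also have "\<dots> = (\<Sum>k. emeasure ?\<nu> (F k))"
    unfolding F_def using transl[OF espan(2) D] by simp
  also have "\<dots> = emeasure ?\<nu> (\<Union>k. F k)"
    by (rule suminf_emeasure) (use F \<open>disjoint_family F\<close> in auto)
  also have "\<dots> \<le> emeasure ?\<nu> C"
  proof (intro emeasure_mono)
    show "(\<Union>k. F k) \<subseteq> C"
      using DP by (force simp: F_def P_def)
  qed (use C in auto)
  finally show ?thesis .
qed

text \<open>Removes the shrinking factor from comparisons of tiles: let \<open>t\<close> tend to 1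
  from below.\<close>

lemma le_of_scaled_le:
  fixes x y :: real
  assumes "\<And>t. 0 < t \<Longrightarrow> t < 1 \<Longrightarrow> t ^ d * x \<le> y"
  shows "x \<le> y"
proof -
  have "((\<lambda>t. t ^ d * x) \<longlongrightarrow> 1 ^ d * x) (at_left (1::real))"
    by (intro tendsto_intros)
  moreover have "\<forall>\<^sub>F t in at_left (1::real). t ^ d * x \<le> y"
    using eventually_at_left_real[OF zero_less_one] by (rule eventually_mono) (use assms in auto)
  ultimately show ?thesis
    by (auto intro: tendsto_upperbound)
qed

lemma measure_packing_le_covering:
  assumes "orthonormal_basis_of (span G) B" "additive_subgroup G" "countable G"
    and "compact A" "compact C"
    and "\<And>a. a \<in> A \<Longrightarrow> \<exists>g\<in>G. a - g \<in> C"
    and "\<And>a a'. a \<in> A \<Longrightarrow> a' \<in> A \<Longrightarrow> a - a' \<in> G \<Longrightarrow> a = a'"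
  shows "measure (span_measure B) A \<le> measure (span_measure B) C"
proof -
  have "finite B" "span B = span G"
    using assms(1) orthonormal_basis_of_independent independent_imp_finite
    by (auto simp: orthonormal_basis_of_def)
  then have "emeasure (span_measure B) A \<le> emeasure (span_measure B) C"
    using assms by (intro packing_le_covering[of B G]) (auto intro: span_base borel_compact)
  moreover have "emeasure (span_measure B) C < \<infinity>"
    using assms by (intro emeasure_span_measure_finite[OF assms(1)])
      (auto intro: borel_compact compact_imp_bounded)
  ultimately show ?thesis
    unfolding measure_def by (intro enn2real_mono) auto
qed

text \<open>The copies of \<open>W\<close> moved by the representatives in \<open>R\<close> together
  form a tile for \<open>N\<close>, so they have the same measure as the tile \<open>A\<close>. Each
  inequality is an instance of \<open>measure_packing_le_covering\<close> modulo \<open>N\<close>,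
  with the packing side shrunk by \<open>t < 1\<close>.\<close>

lemma tiles_index:
  assumes ob: "orthonormal_basis_of (span M) B"
    and M: "additive_subgroup M" and N: "additive_subgroup N" "N \<subseteq> M" "span N = span M"
    and "countable M" and W: "tiles W M" and A: "tiles A N"
    and R: "finite R" "R \<subseteq> M"
    and reps: "\<And>v. v \<in> M \<Longrightarrow> \<exists>r\<in>R. v - r \<in> N"
    and distinct: "\<And>r r'. r \<in> R \<Longrightarrow> r' \<in> R \<Longrightarrow> r - r' \<in> N \<Longrightarrow> r = r'"
  shows "real (card R) * measure (span_measure B) W = measure (span_measure B) A"
proof (rule antisym)
  let ?\<nu> = "span_measure B"
  have fin: "finite B" and spanB: "span B = span M"
    using ob orthonormal_basis_of_independent independent_imp_finite
    by (auto simp: orthonormal_basis_of_def)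
  have obN: "orthonormal_basis_of (span N) B"
    using ob N by simp
  have cN: "countable N"
    using \<open>countable M\<close> N countable_subset by blast
  have cpt: "compact W" "compact A"
    using W A by (auto simp: tiles_def)
  have Wb: "W \<in> sets borel" "A \<in> sets borel"
    using cpt by (auto intro: borel_compact)
  have Rspan: "r \<in> span B" if "r \<in> R" for r
    using R that spanB by (auto intro: span_base)
  have cU: "compact (\<Union>r\<in>R. (+) r ` S)" if "compact S" for S
    using R(1) that by (intro compact_UN compact_translation) auto
  have transl_borel: "(+) r ` S \<in> sets borel" if "compact S" for r :: 'a and S
    using that by (intro borel_compact compact_translation)
  have bounded_fin: "emeasure ?\<nu> S \<noteq> \<infinity>" if "compact S" for S
    using emeasure_span_measure_finite[OF ob compact_imp_bounded[OF that] borel_compact[OF that]] by simp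
  \<comment> \<open>The shrunken \<open>A\<close> packs and the copies \<open>r + W\<close> cover.
    The copies may overlap along their boundaries, which subadditivity tolerates.\<close>
  show "measure ?\<nu> A \<le> real (card R) * measure ?\<nu> W"
  proof (rule le_of_scaled_le[of "card B"])
    fix t :: real assume t: "0 < t" "t < 1"
    have "t ^ card B * measure ?\<nu> A = measure ?\<nu> ((*\<^sub>R) t ` A)"
      by (rule measure_span_measure_scaleR[symmetric]) (use t fin Wb in auto)
    also have "\<dots> \<le> measure ?\<nu> (\<Union>r\<in>R. (+) r ` W)"
    proof (rule measure_packing_le_covering[OF obN N(1) cN])
      show "compact ((*\<^sub>R) t ` A)" "compact (\<Union>r\<in>R. (+) r ` W)"
        using cpt cU by (auto simp: compact_scaling)
    next
      fix a assume "a \<in> (*\<^sub>R) t ` A"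
      then have "a \<in> span M"
        using A N(3) by (auto simp: tiles_def intro!: span_scale)
      then obtain v where v: "v \<in> M" "a - v \<in> W"
        using W unfolding tiles_def by blast
      then obtain r where r: "r \<in> R" "v - r \<in> N"
        using reps by blast
      \<comment> \<open>The vector \<open>v\<close> is only known to lie in \<open>M\<close>.
        Replacing it by \<open>v - r\<close> gives a vector of \<open>N\<close>, at the price of
        landing in the copy \<open>r + W\<close> instead of \<open>W\<close>.\<close>
      have "a - (v - r) = r + (a - v)"
        by simp
      then have "a - (v - r) \<in> (\<Union>r\<in>R. (+) r ` W)"
        using r v by blast
      then show "\<exists>g\<in>N. a - g \<in> (\<Union>r\<in>R. (+) r ` W)"
        using r by blast
    next
      fix a a' assume *: "a \<in> (*\<^sub>R) t ` A" "a' \<in> (*\<^sub>R) t ` A" "a - a' \<in> N"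
      then obtain x y where "a = t *\<^sub>R x" "a' = t *\<^sub>R y" "x \<in> A" "y \<in> A"
        by auto
      then show "a = a'"
        using tiles_packing[OF A t, of x y] * by (simp add: scaleR_diff_right)
    qed
    also have "\<dots> \<le> (\<Sum>r\<in>R. measure ?\<nu> ((+) r ` W))"
      using R(1) transl_borel[OF cpt(1)] bounded_fin[OF compact_translation[OF cpt(1)]]
      by (intro measure_subadditive_finite) auto
    also have "\<dots> = (\<Sum>r\<in>R. measure ?\<nu> W)"
      using Rspan Wb fin by (intro sum.cong refl measure_span_measure_translate) auto
    finally show "t ^ card B * measure ?\<nu> A \<le> real (card R) * measure ?\<nu> W"
      by simp
  qed
  show "real (card R) * measure ?\<nu> W \<le> measure ?\<nu> A"
  proof (rule le_of_scaled_le[of "card B"])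
    fix t :: real assume t: "0 < t" "t < 1"
    have cW: "compact ((*\<^sub>R) t ` W)"
      using cpt by (auto simp: compact_scaling)
    have pack: "x = y" if "x \<in> W" "y \<in> W" "t *\<^sub>R (x - y) \<in> M" for x y
      using tiles_packing[OF W t that] .
    \<comment> \<open>Each copy is shrunk by itself, as \<open>r + t *\<^sub>R x\<close>, not the
      union as a whole: removing \<open>r - r'\<close> from a difference then leaves
      \<open>t *\<^sub>R (x - y)\<close>, to which \<open>pack\<close> applies. The fact serves both
      for disjointness of the copies (difference 0) and for the packing modulo
      \<open>N\<close>.\<close>
    have pack2: "r = r' \<and> x = y"
      if "x \<in> W" "y \<in> W" "r \<in> R" "r' \<in> R" "(r + t *\<^sub>R x) - (r' + t *\<^sub>R y) \<in> N" for x y r r'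
    proof -
      have "t *\<^sub>R (x - y) = ((r + t *\<^sub>R x) - (r' + t *\<^sub>R y)) - (r - r')"
        by (simp add: algebra_simps)
      also have "\<dots> \<in> M"
        using that N(2) R(2) by (intro additive_subgroup_diff[OF M _ additive_subgroup_diff[OF M]]) blast+
      finally have "x = y"
        using pack that by blast
      then show ?thesis
        using distinct[of r r'] that by simp
    qed
    have "t ^ card B * (real (card R) * measure ?\<nu> W) = (\<Sum>r\<in>R. measure ?\<nu> ((*\<^sub>R) t ` W))"
      using measure_span_measure_scaleR[OF fin t(1) Wb(1)] by simp
    also have "\<dots> = (\<Sum>r\<in>R. measure ?\<nu> ((+) r ` (*\<^sub>R) t ` W))"
      using Rspan fin borel_compact[OF cW]
      by (intro sum.cong refl measure_span_measure_translate[symmetric]) auto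
    also have "\<dots> = measure ?\<nu> (\<Union>r\<in>R. (+) r ` (*\<^sub>R) t ` W)"
    proof (rule measure_finite_Union[symmetric])
      show "disjoint_family_on (\<lambda>r. (+) r ` (*\<^sub>R) t ` W) R"
        unfolding disjoint_family_on_def
      proof (intro ballI impI)
        fix r r' assume r: "r \<in> R" "r' \<in> R" "r \<noteq> r'"
        show "(+) r ` (*\<^sub>R) t ` W \<inter> (+) r' ` (*\<^sub>R) t ` W = {}"
        proof (rule ccontr)
          assume "(+) r ` (*\<^sub>R) t ` W \<inter> (+) r' ` (*\<^sub>R) t ` W \<noteq> {}"
          then obtain x y where "x \<in> W" "y \<in> W" "r + t *\<^sub>R x = r' + t *\<^sub>R y"
            by auto
          then show False
            using pack2[of x y r r'] r additive_subgroup_zero[OF N(1)] by simp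
        qed
      qed
    qed (use R(1) transl_borel[OF cW] bounded_fin[OF compact_translation[OF cW]] in auto)
    also have "\<dots> \<le> measure ?\<nu> A"
    proof (rule measure_packing_le_covering[OF obN N(1) cN])
      fix a assume "a \<in> (\<Union>r\<in>R. (+) r ` (*\<^sub>R) t ` W)"
      then obtain r x where "r \<in> R" "x \<in> W" "a = r + t *\<^sub>R x"
        by auto
      then have "a \<in> span N"
        using W R(2) N(3) by (auto simp: tiles_def intro!: span_add span_scale intro: span_base)
      then show "\<exists>g\<in>N. a - g \<in> A"
        using A unfolding tiles_def by blast
    next
      fix a a' assume "a \<in> (\<Union>r\<in>R. (+) r ` (*\<^sub>R) t ` W)" "a' \<in> (\<Union>r\<in>R. (+) r ` (*\<^sub>R) t ` W)" "a - a' \<in> N"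
      then obtain r x r' y where "r \<in> R" "x \<in> W" "r' \<in> R" "y \<in> W"
        and *: "a = r + t *\<^sub>R x" "a' = r' + t *\<^sub>R y" and "a - a' \<in> N"
        by auto
      with pack2[of x y r r'] show "a = a'"
        by (simp only: *)
    qed (use cU cW cpt in auto)
    finally show "t ^ card B * (real (card R) * measure ?\<nu> W) \<le> measure ?\<nu> A" .
  qed
qed

text \<open>Countably many translates of \<open>A\<close> cover the span, so if \<open>A\<close>
  were null the span would be null too. This allows division by the measure of the primitive
  parallelotope.\<close>

lemma tiles_measure_pos:
  assumes ob: "orthonormal_basis_of (span G) B" and "additive_subgroup G" "countable G" "tiles A G"
  shows "measure (span_measure B) A > 0"
proof -
  let ?\<nu> = "span_measure B"
  have fin: "finite B" and spanB: "span B = span G"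
    using ob orthonormal_basis_of_independent independent_imp_finite
    by (auto simp: orthonormal_basis_of_def)
  have A: "compact A" "A \<in> sets borel"
    using assms(4) by (auto simp: tiles_def intro: borel_compact)
  have "emeasure ?\<nu> A \<noteq> 0"
  proof
    assume 0: "emeasure ?\<nu> A = 0"
    have "emeasure ?\<nu> ((+) g ` A) = 0" if "g \<in> G" for g
      using emeasure_span_measure_affine[OF fin _ _ A(2), of g 1] that 0 spanB
      by (auto intro: span_base)
    then have "(+) g ` A \<in> null_sets ?\<nu>" if "g \<in> G" for g
      using that A(1) by (auto intro!: null_setsI borel_compact compact_translation)
    then have null: "(\<Union>g\<in>G. (+) g ` A) \<in> null_sets ?\<nu>"
      using assms(3) by (intro null_sets_UN') auto
    have "span B \<subseteq> (\<Union>g\<in>G. (+) g ` A)"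
    proof
      fix x assume "x \<in> span B"
      then obtain g where "g \<in> G" "x - g \<in> A"
        using assms(4) spanB unfolding tiles_def by blast
      then show "x \<in> (\<Union>g\<in>G. (+) g ` A)"
        by (auto intro!: bexI[of _ g] image_eqI[of _ _ "x - g"])
    qed
    then have "span B \<in> null_sets ?\<nu>"
      by (intro null_sets_subset[OF null]) (auto simp: borel_closed closed_span)
    then show False
      using emeasure_span_measure_span_nonzero[OF fin] by auto
  qed
  moreover have "emeasure ?\<nu> A < \<infinity>"
    using emeasure_span_measure_finite[OF ob compact_imp_bounded[OF A(1)] A(2)] .
  ultimately show ?thesis
    by (simp add: measure_def enn2real_positive_iff zero_less_iff_neq_zero)
qed

section \<open>Parallelotopes as tiles\<close>

lemma group_closure_mono: "S \<subseteq> T \<Longrightarrow> group_closure S \<subseteq> group_closure T"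
  by (rule group_closure_subset[OF additive_subgroup_group_closure]) (auto intro: group_closure.base)

lemma span_group_closure: "span (group_closure S) = span S"
proof (rule span_eq[THEN iffD2], intro conjI)
  have "additive_subgroup (span S)"
    by (simp add: additive_subgroup_def span_zero span_diff)
  then show "group_closure S \<subseteq> span S"
    by (rule group_closure_subset) (rule span_superset)
  show "S \<subseteq> span (group_closure S)"
    by (auto intro: span_base group_closure.base)
qed

lemma group_closure_finite:
  fixes B :: "'a::real_vector set"
  assumes "finite B"
  shows "group_closure B = range (\<lambda>k. \<Sum>b\<in>B. of_int (k b) *\<^sub>R b)"
proof
  have "additive_subgroup (range (\<lambda>k. \<Sum>b\<in>B. of_int (k b) *\<^sub>R b))"
    unfolding additive_subgroup_def
  proof (intro conjI ballI)
    show "0 \<in> range (\<lambda>k. \<Sum>b\<in>B. of_int (k b) *\<^sub>R b)"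
      by (rule range_eqI[of _ _ "\<lambda>_. 0"]) simp
  next
    fix x y assume "x \<in> range (\<lambda>k. \<Sum>b\<in>B. of_int (k b) *\<^sub>R b)"
      "y \<in> range (\<lambda>k. \<Sum>b\<in>B. of_int (k b) *\<^sub>R b)"
    then obtain k l where "x = (\<Sum>b\<in>B. of_int (k b) *\<^sub>R b)" "y = (\<Sum>b\<in>B. of_int (l b) *\<^sub>R b)"
      by auto
    then show "x - y \<in> range (\<lambda>k. \<Sum>b\<in>B. of_int (k b) *\<^sub>R b)"
      by (intro range_eqI[of _ _ "\<lambda>b. k b - l b"]) (simp add: scaleR_diff_left sum_subtractf)
  qed
  moreover have "b \<in> range (\<lambda>k. \<Sum>b\<in>B. of_int (k b) *\<^sub>R b)" if "b \<in> B" for b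
    by (rule range_eqI[of _ _ "\<lambda>x. if x = b then 1 else 0"])
      (use assms that in \<open>simp add: if_distrib[of "\<lambda>k. of_int k *\<^sub>R _"] cong: if_cong\<close>)
  ultimately show "group_closure B \<subseteq> range (\<lambda>k. \<Sum>b\<in>B. of_int (k b) *\<^sub>R b)"
    by (intro group_closure_subset) auto
next
  have G: "additive_subgroup (group_closure B)"
    by (rule additive_subgroup_group_closure)
  show "range (\<lambda>k. \<Sum>b\<in>B. of_int (k b) *\<^sub>R b) \<subseteq> group_closure B"
  proof (rule image_subsetI)
    fix k :: "'a \<Rightarrow> int"
    have "(\<Sum>b\<in>C. of_int (k b) *\<^sub>R b) \<in> group_closure B" if "finite C" "C \<subseteq> B" for C
      using that
      by induction (auto intro!: group_closure_add additive_subgroup_scaleR_int[OF G] intro: group_closure.base)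
    with assms show "(\<Sum>b\<in>B. of_int (k b) *\<^sub>R b) \<in> group_closure B"
      by blast
  qed
qed

definition parallelotope :: "'a::real_vector set \<Rightarrow> 'a set" where
  "parallelotope B = {\<Sum>b\<in>B. t b *\<^sub>R b |t. \<forall>b\<in>B. 0 \<le> t b \<and> t b \<le> 1}"

text \<open>A parallelotope is a Minkowski sum of segments; the induction adds one edge at a
  time.\<close>

lemma compact_parallelotope:
  fixes B :: "'a::real_normed_vector set"
  assumes "finite B"
  shows "compact (parallelotope B)"
  using assms
proof induction
  case empty
  then show ?case
    by (simp add: parallelotope_def)
next
  case (insert b B)
  have "parallelotope (insert b B) = {x + y |x y. x \<in> (\<lambda>t. t *\<^sub>R b) ` {0..1} \<and> y \<in> parallelotope B}"
  proof (intro equalityI subsetI)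
    fix z assume "z \<in> parallelotope (insert b B)"
    then obtain t where t: "\<forall>c\<in>insert b B. 0 \<le> t c \<and> t c \<le> 1"
      and z: "z = (\<Sum>c\<in>insert b B. t c *\<^sub>R c)"
      by (auto simp: parallelotope_def)
    have "z = t b *\<^sub>R b + (\<Sum>c\<in>B. t c *\<^sub>R c)"
      using insert.hyps z by simp
    moreover have "t b *\<^sub>R b \<in> (\<lambda>t. t *\<^sub>R b) ` {0..1}"
      using t by auto
    moreover have "(\<Sum>c\<in>B. t c *\<^sub>R c) \<in> parallelotope B"
      using t unfolding parallelotope_def by blast
    ultimately show "z \<in> {x + y |x y. x \<in> (\<lambda>t. t *\<^sub>R b) ` {0..1} \<and> y \<in> parallelotope B}"
      by blast
  next
    fix z assume "z \<in> {x + y |x y. x \<in> (\<lambda>t. t *\<^sub>R b) ` {0..1} \<and> y \<in> parallelotope B}"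
    then obtain s t where s: "0 \<le> s" "s \<le> 1" and t: "\<forall>b\<in>B. 0 \<le> t b \<and> t b \<le> 1"
      and z: "z = s *\<^sub>R b + (\<Sum>b\<in>B. t b *\<^sub>R b)"
      by (auto simp: parallelotope_def)
    have "(\<Sum>c\<in>B. (t(b := s)) c *\<^sub>R c) = (\<Sum>c\<in>B. t c *\<^sub>R c)"
      using insert.hyps by (intro sum.cong) auto
    then have "z = (\<Sum>c\<in>insert b B. (t(b := s)) c *\<^sub>R c)"
      using insert.hyps z by simp
    moreover have "\<forall>c\<in>insert b B. 0 \<le> (t(b := s)) c \<and> (t(b := s)) c \<le> 1"
      using s t by auto
    ultimately show "z \<in> parallelotope (insert b B)"
      unfolding parallelotope_def by blast
  qed
  moreover have "compact ((\<lambda>t. t *\<^sub>R b) ` {0..1::real})"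
    by (intro compact_continuous_image continuous_intros) auto
  ultimately show ?case
    using compact_sums[of "(\<lambda>t. t *\<^sub>R b) ` {0..1}" "parallelotope B"] insert.IH by simp
qed

text \<open>Covering: subtract the integer parts of the coordinates. Packing: the coordinates of two
  points differ by at most 1, so after scaling by \<open>t < 1\<close> a difference with integer
  coordinates must vanish.\<close>

lemma tiles_parallelotope:
  fixes B :: "'a::euclidean_space set"
  assumes "independent B"
  shows "tiles (parallelotope B) (group_closure B)"
proof -
  have fin: "finite B"
    using assms by (rule independent_imp_finite)
  show ?thesis
    unfolding tiles_def span_group_closure
  proof (intro conjI allI impI ballI)
    show "compact (parallelotope B)"
      by (rule compact_parallelotope) fact
    show "parallelotope B \<subseteq> span B"
      by (auto simp: parallelotope_def intro!: span_sum span_scale intro: span_base)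
  next
    fix x assume "x \<in> span B"
    then obtain c where c: "x = (\<Sum>b\<in>B. c b *\<^sub>R b)"
      using fin by (auto simp: span_finite)
    let ?g = "\<Sum>b\<in>B. of_int \<lfloor>c b\<rfloor> *\<^sub>R b"
    have "x - ?g = (\<Sum>b\<in>B. frac (c b) *\<^sub>R b)"
      by (simp add: c frac_def scaleR_diff_left sum_subtractf)
    then have "x - ?g \<in> parallelotope B"
      unfolding parallelotope_def
      by (intro CollectI exI[of _ "\<lambda>b. frac (c b)"] conjI) (auto intro: less_imp_le frac_lt_1)
    moreover have "?g \<in> group_closure B"
      unfolding group_closure_finite[OF fin] by (rule range_eqI[of _ _ "\<lambda>b. \<lfloor>c b\<rfloor>"]) simp
    ultimately show "\<exists>g\<in>group_closure B. x - g \<in> parallelotope B"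
      by blast
  next
    fix t x y
    assume *: "0 < t \<and> t < 1 \<and> x \<in> parallelotope B \<and> y \<in> parallelotope B \<and>
      t *\<^sub>R (x - y) \<in> group_closure B"
    then obtain u v k where u: "x = (\<Sum>b\<in>B. u b *\<^sub>R b)" "\<forall>b\<in>B. 0 \<le> u b \<and> u b \<le> 1"
      and v: "y = (\<Sum>b\<in>B. v b *\<^sub>R b)" "\<forall>b\<in>B. 0 \<le> v b \<and> v b \<le> 1"
      and k: "t *\<^sub>R (x - y) = (\<Sum>b\<in>B. of_int (k b) *\<^sub>R b)"
      unfolding group_closure_finite[OF fin] parallelotope_def by blast
    have "u b = v b" if "b \<in> B" for b
    proof -
      have "(\<Sum>b\<in>B. (t * (u b - v b) - of_int (k b)) *\<^sub>R b) = t *\<^sub>R (x - y) - (\<Sum>b\<in>B. of_int (k b) *\<^sub>R b)"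
        by (simp add: u v scaleR_diff_left sum_subtractf scaleR_sum_right right_diff_distrib
            scaleR_diff_right)
      also have "\<dots> = 0"
        using k by simp
      finally have "t * (u b - v b) - of_int (k b) = 0"
        using independentD[OF assms fin subset_refl, of "\<lambda>b. t * (u b - v b) - of_int (k b)"] that by simp
      then have eq: "t * (u b - v b) = of_int (k b)"
        by simp
      have "0 \<le> u b" "u b \<le> 1" "0 \<le> v b" "v b \<le> 1"
        using u(2) v(2) that by auto
      then have "\<bar>u b - v b\<bar> \<le> 1"
        by linarith
      then have "\<bar>t * (u b - v b)\<bar> \<le> t"
        using * by (simp add: abs_mult mult_left_le)
      then have "k b = 0"
        using * eq by linarith
      then show ?thesis
        using eq * by simp
    qed
    then show "x = y"
      using u v by (auto intro: sum.cong)
  qed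
qed

section \<open>Voronoi cells as tiles\<close>

definition voronoi_cell :: "'a::euclidean_space set \<Rightarrow> 'a set" where
  "voronoi_cell M = {y \<in> span M. \<forall>v\<in>M. norm y \<le> norm (y - v)}"

lemma norm_le_norm_diff_iff: "norm y \<le> norm (y - v) \<longleftrightarrow> 2 * (y \<bullet> v) \<le> v \<bullet> v"
  by (simp add: norm_le inner_diff_left inner_diff_right inner_commute)

text \<open>Covering: a discrete subgroup is closed, so every point has a nearest element of
  \<open>M\<close>. Packing: for \<open>v = t *\<^sub>R (x - y)\<close> the cell inequalities of
  \<open>x\<close> at \<open>v\<close> and of \<open>y\<close> at \<open>- v\<close> add up to
  \<open>(x - y) \<bullet> v \<le> v \<bullet> v\<close>, that is \<open>t \<le> t\<^sup>2\<close>
  unless \<open>x = y\<close>.\<close>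

lemma tiles_voronoi_cell:
  fixes M :: "'a::euclidean_space set"
  assumes M: "additive_subgroup M" and "\<epsilon> > 0" and discrete: "\<And>v. v \<in> M \<Longrightarrow> norm v < \<epsilon> \<Longrightarrow> v = 0"
  shows "tiles (voronoi_cell M) M"
  unfolding tiles_def
proof (intro conjI allI impI ballI)
  have "closed M"
  proof (rule discrete_imp_closed[OF \<open>\<epsilon> > 0\<close>], intro ballI impI)
    fix x y assume "x \<in> M" "y \<in> M" "dist y x < \<epsilon>"
    then show "y = x"
      using discrete[of "y - x"] additive_subgroup_diff[OF M, of y x] by (simp add: dist_norm)
  qed
  have "voronoi_cell M = span M \<inter> (\<Inter>v\<in>M. {y. norm y \<le> norm (y - v)})"
    by (auto simp: voronoi_cell_def)
  also have "closed \<dots>"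
    by (intro closed_Int closed_span closed_INT ballI closed_Collect_le continuous_intros)
  finally have "closed (voronoi_cell M)" .
  moreover have "bounded (voronoi_cell M)"
  proof -
    \<comment> \<open>\<open>B\<close> may generate a proper subgroup of \<open>M\<close>. Its
      parallelotope still brings some \<open>g\<close> in \<open>M\<close> within a fixed distance
      \<open>r\<close> of every point of the span, and a point of the cell is no farther from 0 than
      from \<open>g\<close>.\<close>
    obtain B where B: "B \<subseteq> M" "independent B" "M \<subseteq> span B"
      using maximal_independent_subset by blast
    then have "span B = span M"
      by (intro span_eq[THEN iffD2]) (auto intro: span_base)
    then have tiles: "tiles (parallelotope B) (group_closure B)" and span: "span (group_closure B) = span M"
      using B by (auto intro: tiles_parallelotope simp: span_group_closure)
    have sub: "group_closure B \<subseteq> M"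
      using M B(1) by (rule group_closure_subset)
    from tiles have "bounded (parallelotope B)"
      by (auto simp: tiles_def intro: compact_imp_bounded)
    then obtain r where r: "\<And>x. x \<in> parallelotope B \<Longrightarrow> norm x \<le> r"
      by (auto simp: bounded_iff)
    have "norm y \<le> r" if "y \<in> voronoi_cell M" for y
    proof -
      have "y \<in> span (group_closure B)"
        using that span by (simp add: voronoi_cell_def)
      then obtain g where "g \<in> group_closure B" "y - g \<in> parallelotope B"
        using tiles unfolding tiles_def by blast
      then show ?thesis
        using that sub r[of "y - g"] by (force simp: voronoi_cell_def)
    qed
    then show ?thesis
      by (auto simp: bounded_iff)
  qed
  ultimately show "compact (voronoi_cell M)"
    by (simp add: compact_eq_bounded_closed)
  show "voronoi_cell M \<subseteq> span M"
    by (auto simp: voronoi_cell_def)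
  fix x assume x: "x \<in> span M"
  obtain g where g: "g \<in> M" "\<And>h. h \<in> M \<Longrightarrow> dist x g \<le> dist x h"
    using distance_attains_inf[OF \<open>closed M\<close>] additive_subgroup_zero[OF M] by (metis empty_iff)
  have "norm (x - g) \<le> norm (x - g - v)" if "v \<in> M" for v
    using g(2)[OF additive_subgroup_add[OF M g(1) that]] by (simp add: dist_norm diff_diff_eq)
  then have "x - g \<in> voronoi_cell M"
    using x g(1) by (auto simp: voronoi_cell_def intro: span_diff span_base)
  with g(1) show "\<exists>g\<in>M. x - g \<in> voronoi_cell M"
    by blast
next
  fix t x y
  assume *: "0 < t \<and> t < 1 \<and> x \<in> voronoi_cell M \<and> y \<in> voronoi_cell M \<and> t *\<^sub>R (x - y) \<in> M"
  let ?v = "t *\<^sub>R (x - y)"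
  have "norm x \<le> norm (x - ?v)" "norm y \<le> norm (y - - ?v)"
    using * additive_subgroup_minus[OF M, of ?v] unfolding voronoi_cell_def by blast+
  then have "2 * (x \<bullet> ?v) \<le> ?v \<bullet> ?v" "2 * (y \<bullet> - ?v) \<le> - ?v \<bullet> - ?v"
    by (simp_all only: norm_le_norm_diff_iff)
  then have "2 * (x \<bullet> ?v) \<le> ?v \<bullet> ?v" "- (2 * (y \<bullet> ?v)) \<le> ?v \<bullet> ?v"
    by (simp_all only: inner_minus_left inner_minus_right mult_minus_right minus_minus)
  moreover have "(x - y) \<bullet> ?v = x \<bullet> ?v - y \<bullet> ?v"
    by (rule inner_diff_left)
  ultimately have "(x - y) \<bullet> ?v \<le> ?v \<bullet> ?v"
    by linarith
  then have "t * (norm (x - y))\<^sup>2 \<le> t * (t * (norm (x - y))\<^sup>2)"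
    by (simp add: power2_norm_eq_inner)
  then have "(norm (x - y))\<^sup>2 \<le> t * (norm (x - y))\<^sup>2"
    using * by simp
  then have "(1 - t) * (norm (x - y))\<^sup>2 \<le> 0"
    by (simp add: algebra_simps)
  then show "x = y"
    using * by (simp add: mult_le_0_iff)
qed

text \<open>Nonzero elements of \<open>M\<close> have norm at least \<open>\<epsilon>\<close>, so
  the cell contains all points of \<open>span M\<close> of norm \<open>\<epsilon> / 2\<close>. This
  determines the affine hull of the slice.\<close>

lemma span_voronoi_cell:
  fixes M :: "'a::euclidean_space set"
  assumes "\<epsilon> > 0" and discrete: "\<And>v. v \<in> M \<Longrightarrow> norm v < \<epsilon> \<Longrightarrow> v = 0"
  shows "span (voronoi_cell M) = span M"
proof
  show "span (voronoi_cell M) \<subseteq> span M"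
    by (rule span_minimal) (auto simp: voronoi_cell_def)
  show "span M \<subseteq> span (voronoi_cell M)"
  proof
    fix x assume x: "x \<in> span M"
    show "x \<in> span (voronoi_cell M)"
    proof (cases "x = 0")
      case False
      define y where "y = (\<epsilon> / (2 * norm x)) *\<^sub>R x"
      have norm_y: "norm y = \<epsilon> / 2"
        using False \<open>\<epsilon> > 0\<close> by (simp add: y_def)
      have "norm y \<le> norm (y - v)" if "v \<in> M" for v
      proof (cases "v = 0")
        case False
        then have "\<epsilon> \<le> norm v"
          using discrete[OF that] by fastforce
        then show ?thesis
          using norm_triangle_ineq2[of v y] by (simp add: norm_y norm_minus_commute)
      qed simp
      then have "y \<in> voronoi_cell M"
        using x by (auto simp: voronoi_cell_def y_def intro: span_scale)
      then have "(2 * norm x / \<epsilon>) *\<^sub>R y \<in> span (voronoi_cell M)"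
        by (intro span_scale span_base)
      then show ?thesis
        using False \<open>\<epsilon> > 0\<close> by (simp add: y_def)
    qed (simp add: span_zero)
  qed
qed

lemma span_parallelotope:
  assumes "finite B"
  shows "span (parallelotope B) = span B"
proof (rule span_eq[THEN iffD2], intro conjI subsetI)
  fix x assume "x \<in> parallelotope B"
  then show "x \<in> span B"
    by (auto simp: parallelotope_def intro!: span_sum span_scale intro: span_base)
next
  fix b assume "b \<in> B"
  then have "b = (\<Sum>x\<in>B. (if x = b then 1 else 0) *\<^sub>R x)"
    using assms by (simp add: if_distrib[of "\<lambda>c. c *\<^sub>R _"] cong: if_cong)
  then have "b \<in> parallelotope B"
    unfolding parallelotope_def by (intro CollectI exI[of _ "\<lambda>x. if x = b then 1 else 0"]) simp
  then show "b \<in> span (parallelotope B)"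
    by (rule span_base)
qed

lemma zero_in_parallelotope: "0 \<in> parallelotope B"
  unfolding parallelotope_def by (intro CollectI exI[of _ "\<lambda>_. 0"]) simp

section \<open>Sublattices of the integer lattice\<close>

lemma additive_subgroup_integer_points: "additive_subgroup integer_points"
  by (auto simp: additive_subgroup_def integer_points_def)

text \<open>Elimination as for a Hermite normal form, where \<open>I\<close> holds the coordinates
  that may be nonzero on \<open>G\<close>. The values of coordinate \<open>i\<close> form a subgroup
  of the integers. If its generator is nonzero, a vector \<open>v\<close> attaining it extends a
  basis of \<open>G0\<close>, the part where that coordinate vanishes; otherwise
  \<open>G = G0\<close>.\<close>

lemma integer_subgroup_basis:
  fixes G :: "(real ^ 'n) set"
  assumes "additive_subgroup G" "G \<subseteq> integer_points"
  shows "\<exists>B. independent B \<and> group_closure B = G"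
proof -
  have "\<exists>B. independent B \<and> group_closure B = G"
    if "finite I" "additive_subgroup G" "G \<subseteq> integer_points" "\<And>x i. x \<in> G \<Longrightarrow> i \<notin> I \<Longrightarrow> x $ i = 0"
    for I :: "'n set" and G :: "(real ^ 'n) set"
    using that
  proof (induction I arbitrary: G)
    case empty
    then have "G = {0}"
      by (auto simp: vec_eq_iff additive_subgroup_zero)
    then show ?case
      by (intro exI[of _ "{}"]) (simp add: independent_empty)
  next
    case (insert i I)
    note G = insert.prems(1)
    define A where "A = {k::int. \<exists>x\<in>G. x $ i = of_int k}"
    have "additive_subgroup A"
      unfolding additive_subgroup_def
    proof (intro conjI ballI)
      show "0 \<in> A"
        using additive_subgroup_zero[OF G] by (auto simp: A_def intro!: bexI[of _ 0])
    next
      fix k l assume "k \<in> A" "l \<in> A"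
      then obtain x y where "x \<in> G" "y \<in> G" "x $ i = of_int k" "y $ i = of_int l"
        by (auto simp: A_def)
      then show "k - l \<in> A"
        using additive_subgroup_diff[OF G] by (auto simp: A_def intro!: bexI[of _ "x - y"])
    qed
    then have "Gcd A \<in> A"
      using group_closure_subset[OF _ subset_refl] Gcd_in_group_closure by blast
    then obtain v where v: "v \<in> G" "v $ i = of_int (Gcd A)"
      by (auto simp: A_def)
    define G0 where "G0 = {x \<in> G. x $ i = 0}"
    have "additive_subgroup G0" "G0 \<subseteq> integer_points"
      using G insert.prems(2) by (auto simp: G0_def additive_subgroup_def)
    moreover have "x $ j = 0" if "x \<in> G0" "j \<notin> I" for x j
      using that insert.prems(3) by (cases "j = i") (auto simp: G0_def)
    ultimately obtain B where B: "independent B" "group_closure B = G0"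
      using insert.IH[of G0] by metis
    have reduce: "\<exists>q. x - of_int q *\<^sub>R v \<in> G0" if x: "x \<in> G" for x
    proof -
      obtain k where k: "x $ i = of_int k"
        using x insert.prems(2) unfolding integer_points_def by (blast elim: Ints_cases)
      then have "Gcd A dvd k"
        using x by (intro Gcd_dvd) (auto simp: A_def)
      then obtain q where "k = Gcd A * q" ..
      then have "(x - of_int q *\<^sub>R v) $ i = 0"
        using k v by simp
      moreover have "x - of_int q *\<^sub>R v \<in> G"
        by (intro additive_subgroup_diff[OF G] additive_subgroup_scaleR_int[OF G] x v)
      ultimately show ?thesis
        by (auto simp: G0_def)
    qed
    show ?case
    proof (cases "Gcd A = 0")
      case True
      then have "A \<subseteq> {0}"
        by simp
      then have "G \<subseteq> G0"
        using reduce v True unfolding G0_def by (auto simp: algebra_simps)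
      then have "G = G0"
        by (auto simp: G0_def)
      then show ?thesis
        using B by blast
    next
      case False
      have "subspace {x :: real ^ 'n. x $ i = 0}"
        by (simp add: subspace_def)
      then have "span B \<subseteq> {x. x $ i = 0}"
        using B(2) by (intro span_minimal) (auto simp: G0_def intro: group_closure.base)
      moreover have "v $ i \<noteq> 0"
        unfolding v(2) of_int_eq_0_iff by (rule False)
      ultimately have "v \<notin> span B"
        by blast
      then have "independent (insert v B)"
        using B by (simp add: independent_insert)
      moreover have "group_closure (insert v B) = G"
      proof
        have "B \<subseteq> G0"
          using B(2) by (auto intro: group_closure.base)
        then show "group_closure (insert v B) \<subseteq> G"
          using v by (intro group_closure_subset[OF G]) (auto simp: G0_def)
        show "G \<subseteq> group_closure (insert v B)"
        proof
          fix x assume "x \<in> G"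
          then obtain q where "x - of_int q *\<^sub>R v \<in> G0"
            using reduce by blast
          then have "x - of_int q *\<^sub>R v \<in> group_closure (insert v B)"
            using B(2) group_closure_mono[of B "insert v B"] by blast
          moreover have "of_int q *\<^sub>R v \<in> group_closure (insert v B)"
            by (intro additive_subgroup_scaleR_int additive_subgroup_group_closure group_closure.base) auto
          ultimately have "x - of_int q *\<^sub>R v + of_int q *\<^sub>R v \<in> group_closure (insert v B)"
            by (rule group_closure_add)
          then show "x \<in> group_closure (insert v B)"
            by simp
        qed
      qed
      ultimately show ?thesis
        by blast
    qed
  qed
  from this[of UNIV G] assms show ?thesis
    by simp
qed

lemma integer_points_discrete:
  assumes "v \<in> integer_points" "norm v < 1"
  shows "v = 0"
proof -
  have "v $ i = 0" for i
  proof -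
    have "\<bar>v $ i\<bar> < 1"
      using component_le_norm_cart[of v i] assms(2) by linarith
    moreover have "v $ i \<in> \<int>"
      using assms(1) by (simp add: integer_points_def)
    ultimately show ?thesis
      by (auto elim!: Ints_cases)
  qed
  then show ?thesis
    by (simp add: vec_eq_iff)
qed

lemma countable_integer_points: "countable (integer_points :: (real ^ 'n) set)"
proof -
  have "integer_points \<subseteq> range (\<lambda>k::'n \<Rightarrow> int. \<chi> i. real_of_int (k i))"
  proof
    fix x :: "real ^ 'n" assume "x \<in> integer_points"
    then have "x = (\<chi> i. real_of_int \<lfloor>x $ i\<rfloor>)"
      by (auto simp: vec_eq_iff integer_points_def elim!: Ints_cases)
    then show "x \<in> range (\<lambda>k::'n \<Rightarrow> int. \<chi> i. real_of_int (k i))"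
      by (rule image_eqI[of _ _ "\<lambda>i. \<lfloor>x $ i\<rfloor>"]) simp
  qed
  then show ?thesis
    by (rule countable_subset) simp
qed

lemma primitive_parallelotope_translateE:
  fixes E :: "(real ^ 'n) set"
  assumes "primitive_parallelotope ((+) c ` E) Q" "subspace E"
  obtains p B where "independent B" "group_closure B = E \<inter> integer_points"
    "(+) p ` E = (+) c ` E" "Q = (+) p ` parallelotope B"
proof -
  from assms(1) obtain p B where p: "p \<in> (+) c ` E" and B: "independent B"
      "group_closure B = direction_lattice ((+) c ` E)"
    and Q: "Q = {p + (\<Sum>b\<in>B. t b *\<^sub>R b) |t. \<forall>b\<in>B. 0 \<le> t b \<and> t b \<le> 1}"
    unfolding primitive_parallelotope_def by blast
  from p obtain e where e: "e \<in> E" "p = c + e"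
    by blast
  have "(+) e ` E = E"
  proof (intro equalityI subsetI)
    fix x assume "x \<in> E"
    then show "x \<in> (+) e ` E"
      using subspace_diff[OF assms(2) _ e(1)] by (intro image_eqI[of _ _ "x - e"]) auto
  qed (use subspace_add[OF assms(2) e(1)] in auto)
  moreover have "(+) p ` E = (+) c ` (+) e ` E"
    by (simp add: e(2) image_image add.assoc)
  ultimately have "(+) p ` E = (+) c ` E"
    by simp
  moreover have "Q = (+) p ` parallelotope B"
    unfolding Q parallelotope_def by blast
  ultimately show ?thesis
    using B that[of B p] by (simp add: direction_lattice_def direction_space_translate[OF assms(2)])
qed

text \<open>Makes the choice of a parallelotope in \<open>normalized_volume\<close> meaningful. As
  the integer points of \<open>E\<close> span it, a lattice basis has exactly \<open>dim E\<close>
  elements.\<close>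

lemma ex_primitive_parallelotope:
  fixes E :: "(real ^ 'n) set"
  assumes "subspace E" "span (E \<inter> integer_points) = E"
  shows "\<exists>Q. primitive_parallelotope ((+) c ` E) Q"
proof -
  let ?L = "(+) c ` E"
  have "additive_subgroup (E \<inter> integer_points)"
    using additive_subgroup_integer_points assms(1)
    by (auto simp: additive_subgroup_def subspace_0 subspace_diff)
  then obtain B where B: "independent B" "group_closure B = E \<inter> integer_points"
    using integer_subgroup_basis by blast
  then have "span B = E"
    using span_group_closure[of B] assms(2) by simp
  then have "card B = dim E"
    using B(1) dim_eq_card by (metis span_eq_iff assms(1))
  then have "int (card B) = aff_dim ?L"
    using aff_dim_subspace[OF assms(1)] by (simp add: aff_dim_translation_eq)
  \<comment> \<open>An integer vertex if \<open>?L\<close> contains one, and any point of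
    \<open>?L\<close> otherwise.\<close>
  moreover obtain p where "p \<in> ?L" "?L \<inter> integer_points \<noteq> {} \<longrightarrow> p \<in> integer_points"
    using subspace_0[OF assms(1)] by (cases "?L \<inter> integer_points = {}") blast+
  ultimately show ?thesis
    using B unfolding primitive_parallelotope_def direction_lattice_def direction_space_translate[OF assms(1)]
    by blast
qed

section \<open>Inequalities for the permutahedron\<close>

text \<open>Stated with \<open>\<sigma>\<close> instead of the inverse in \<open>perm_act\<close>,
  so that constancy along cycles follows by induction on \<open>orbit\<close>;
  \<open>perm_act_fixed_iff\<close> links the two forms.\<close>

definition fixed_space :: "('n \<Rightarrow> 'n) \<Rightarrow> (real ^ 'n) set" where
  "fixed_space \<sigma> = {x. \<forall>i. x $ \<sigma> i = x $ i}"

definition slice_space :: "('n::finite \<Rightarrow> 'n) \<Rightarrow> (real ^ 'n) set" where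
  "slice_space \<sigma> = {x \<in> fixed_space \<sigma>. (\<Sum>i\<in>UNIV. x $ i) = 0}"

lemma subspace_fixed_space: "subspace (fixed_space \<sigma>)"
  by (auto simp: fixed_space_def subspace_def)

lemma subspace_slice_space: "subspace (slice_space \<sigma>)"
  using subspace_fixed_space[of \<sigma>]
  by (auto simp: slice_space_def subspace_def sum.distrib simp flip: sum_distrib_left)

lemma perm_act_fixed_iff:
  assumes "\<sigma> permutes UNIV"
  shows "perm_act \<sigma> x = x \<longleftrightarrow> x \<in> fixed_space \<sigma>"
proof -
  have "(\<forall>i. x $ inv \<sigma> i = x $ i) \<longleftrightarrow> (\<forall>i. x $ \<sigma> i = x $ i)"
    using permutes_inverses[OF assms] by metis
  then show ?thesis
    by (simp add: perm_act_def fixed_space_def vec_eq_iff)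
qed

section \<open>Symmetry, compactness and vertices of the permutahedron\<close>

lemma linear_perm_act: "linear (perm_act \<sigma>)"
  by (auto simp: perm_act_def linear_iff vec_eq_iff)

lemma norm_perm_act:
  assumes "\<sigma> permutes UNIV"
  shows "norm (perm_act \<sigma> x) = norm (x :: real ^ 'n)"
proof -
  have "(\<Sum>i\<in>UNIV. (x $ inv \<sigma> i)\<^sup>2) = (\<Sum>i\<in>UNIV. (x $ i)\<^sup>2)"
    using sum.permute[OF permutes_inv[OF assms], of "\<lambda>i. (x $ i)\<^sup>2"] by (simp add: o_def)
  then show ?thesis
    by (simp add: perm_act_def norm_vec_def L2_set_def)
qed

lemma perm_act_permutahedron:
  fixes \<sigma> :: "'n::finite \<Rightarrow> 'n"
  assumes "\<sigma> permutes UNIV" "p \<in> permutahedron"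
  shows "perm_act \<sigma> p \<in> permutahedron"
proof -
  let ?V = "{(\<chi> i. real (\<pi> i)) |\<pi>. bij_betw \<pi> (UNIV :: 'n set) {1..CARD('n)}} :: (real ^ 'n) set"
  have "perm_act \<sigma> ` ?V \<subseteq> ?V"
  proof
    fix x assume "x \<in> perm_act \<sigma> ` ?V"
    then obtain \<pi> where \<pi>: "bij_betw \<pi> (UNIV :: 'n set) {1..CARD('n)}"
      and x: "x = perm_act \<sigma> (\<chi> i. real (\<pi> i))"
      by auto
    have "bij_betw (\<pi> \<circ> inv \<sigma>) UNIV {1..CARD('n)}"
      using permutes_imp_bij[OF permutes_inv[OF assms(1)]] \<pi> by (rule bij_betw_trans)
    then show "x \<in> ?V"
      unfolding x perm_act_def by (intro CollectI exI[of _ "\<pi> \<circ> inv \<sigma>"]) simp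
  qed
  then have "convex hull (perm_act \<sigma> ` ?V) \<subseteq> permutahedron"
    unfolding permutahedron_def by (rule hull_mono)
  moreover have "perm_act \<sigma> p \<in> perm_act \<sigma> ` (convex hull ?V)"
    using assms(2) unfolding permutahedron_def by (rule imageI)
  ultimately show ?thesis
    by (auto simp: convex_hull_linear_image[OF linear_perm_act])
qed

lemma compact_permutahedron: "compact (permutahedron :: (real ^ 'n) set)"
proof -
  let ?P = "{\<pi>. bij_betw \<pi> (UNIV :: 'n set) {1..CARD('n)}}"
  have "?P \<subseteq> (\<Pi>\<^sub>E i\<in>UNIV. {1..CARD('n)})"
    by (auto simp: bij_betw_def)
  then have "finite ?P"
    by (rule finite_subset) (intro finite_PiE, auto)
  moreover have "{(\<chi> i. real (\<pi> i)) |\<pi>. bij_betw \<pi> (UNIV :: 'n set) {1..CARD('n)}} =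
      (\<lambda>\<pi>. \<chi> i. real (\<pi> i)) ` ?P"
    by auto
  ultimately show ?thesis
    unfolding permutahedron_def by (intro compact_convex_hull finite_imp_compact) simp
qed

text \<open>Supplies the vertex of the permutahedron sorted like \<open>a\<close>, at which the
  functional \<open>a\<close> is maximal. Equal values of \<open>a\<close> may be ranked in any
  order, hence the implication in one direction only.\<close>

lemma ex_sorting_bij:
  fixes a :: "'n::finite \<Rightarrow> 'b::linorder"
  obtains \<pi> where "bij_betw \<pi> (UNIV :: 'n set) {1..CARD('n)}" "\<And>i j. a i < a j \<Longrightarrow> \<pi> i < \<pi> j"
proof -
  obtain ys where ys: "set ys = (UNIV :: 'n set)" "distinct ys"
    using finite_distinct_list[of "UNIV :: 'n set"] by auto
  define xs where "xs = sort_key a ys"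
  have xs: "set xs = UNIV" "distinct xs" "sorted (map a xs)"
    using ys by (simp_all add: xs_def)
  have len: "length xs = CARD('n)"
    using xs distinct_card by fastforce
  have bij: "bij_betw ((!) xs) {..<CARD('n)} UNIV"
    using xs len by (intro bij_betw_nth) auto
  define f where "f = the_inv_into {..<CARD('n)} ((!) xs)"
  have f: "bij_betw f UNIV {..<CARD('n)}"
    unfolding f_def by (rule bij_betw_the_inv_into) (rule bij)
  have nth_f: "xs ! f i = i" for i
    using bij unfolding f_def by (intro f_the_inv_into_f) (auto simp: bij_betw_def)
  have f_less: "f i < CARD('n)" for i
    using f by (auto simp: bij_betw_def)
  have "bij_betw Suc {..<CARD('n)} {1..CARD('n)}"
    by (auto simp: bij_betw_def image_Suc_lessThan)
  then have "bij_betw (Suc \<circ> f) UNIV {1..CARD('n)}"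
    using f by (intro bij_betw_trans)
  moreover have "(Suc \<circ> f) i < (Suc \<circ> f) j" if "a i < a j" for i j
  proof (rule ccontr)
    assume "\<not> (Suc \<circ> f) i < (Suc \<circ> f) j"
    then have "map a xs ! f j \<le> map a xs ! f i"
      using xs len f_less by (intro sorted_nth_mono) auto
    then show False
      using that len f_less by (simp add: nth_f)
  qed
  ultimately show ?thesis
    by (rule that)
qed

text \<open>There are \<open>p - 1\<close> terms equal to 1, one equal to 0 and \<open>n - p\<close>
  equal to -1.\<close>

lemma sum_sgn_diff:
  assumes "p \<in> {1..n}"
  shows "(\<Sum>k=1..n. sgn (real p - real k)) = 2 * real p - real n - 1"
proof -
  have "{1..n} = {1..<p} \<union> {p} \<union> {p<..n}"
    using assms by auto
  then have "(\<Sum>k=1..n. sgn (real p - real k)) =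
      (\<Sum>k\<in>{1..<p}. sgn (real p - real k)) + sgn (real p - real p) + (\<Sum>k\<in>{p<..n}. sgn (real p - real k))"
    by (simp only:) (subst sum.union_disjoint; auto)+
  also have "(\<Sum>k\<in>{1..<p}. sgn (real p - real k)) = (\<Sum>k\<in>{1..<p}. 1)"
    by (intro sum.cong) auto
  also have "(\<Sum>k\<in>{p<..n}. sgn (real p - real k)) = (\<Sum>k\<in>{p<..n}. - 1)"
    by (intro sum.cong) auto
  finally show ?thesis
    using assms by (simp add: of_nat_diff)
qed

text \<open>The zonotope form of the permutahedron. By \<open>sum_sgn_diff\<close> the signs in row
  \<open>i\<close> add up to twice the centred coordinate, and antisymmetry of the sign makes the
  \<open>a i\<close> and the \<open>a j\<close> parts of the double sum equal, which gives another
  factor 2. This is the origin of the 4 in the later bounds.\<close>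

lemma vertex_pairing:
  fixes a :: "'n::finite \<Rightarrow> real"
  assumes "bij_betw \<pi> (UNIV :: 'n set) {1..CARD('n)}"
  shows "4 * (\<Sum>i\<in>UNIV. (real (\<pi> i) - (real CARD('n) + 1) / 2) * a i) =
    (\<Sum>i\<in>UNIV. \<Sum>j\<in>UNIV. sgn (real (\<pi> i) - real (\<pi> j)) * (a i - a j))"
proof -
  have row: "(\<Sum>j\<in>UNIV. sgn (real (\<pi> i) - real (\<pi> j))) = 2 * real (\<pi> i) - real CARD('n) - 1" for i
  proof -
    have "(\<Sum>j\<in>UNIV. sgn (real (\<pi> i) - real (\<pi> j))) = (\<Sum>k=1..CARD('n). sgn (real (\<pi> i) - real k))"
      by (rule sum.reindex_bij_betw[OF assms])
    also have "\<dots> = 2 * real (\<pi> i) - real CARD('n) - 1"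
      using assms by (intro sum_sgn_diff) (auto simp: bij_betw_def)
    finally show ?thesis .
  qed
  let ?s = "\<lambda>i j. sgn (real (\<pi> i) - real (\<pi> j))"
  have "(\<Sum>i\<in>UNIV. \<Sum>j\<in>UNIV. ?s i j * (a i - a j)) =
      (\<Sum>i\<in>UNIV. \<Sum>j\<in>UNIV. ?s i j * a i) + (\<Sum>i\<in>UNIV. \<Sum>j\<in>UNIV. ?s j i * a j)"
  proof -
    have "?s i j * (a i - a j) = ?s i j * a i + ?s j i * a j" for i j
      using sgn_minus[of "real (\<pi> i) - real (\<pi> j)"] by (simp add: algebra_simps)
    then show ?thesis
      by (simp add: sum.distrib)
  qed
  also have "(\<Sum>i\<in>UNIV. \<Sum>j\<in>UNIV. ?s j i * a j) = (\<Sum>i\<in>UNIV. \<Sum>j\<in>UNIV. ?s i j * a i)"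
    by (rule sum.swap)
  also have "(\<Sum>i\<in>UNIV. \<Sum>j\<in>UNIV. ?s i j * a i) = (\<Sum>i\<in>UNIV. (2 * real (\<pi> i) - real CARD('n) - 1) * a i)"
    by (simp add: row flip: sum_distrib_right)
  also have "\<dots> = (\<Sum>i\<in>UNIV. 2 * ((real (\<pi> i) - (real CARD('n) + 1) / 2) * a i))"
    by (intro sum.cong refl) (simp add: field_simps)
  finally show ?thesis
    by (simp flip: sum_distrib_left)
qed

text \<open>
  The level sets of \<open>a\<close> form a chain, and both sides are additive along it (Lovasz extension); each
  step subtracts a multiple of the indicator of the set where \<open>a\<close> is maximal.
\<close>

lemma abs_pairing_bound:
  fixes y a :: "real ^ 'n"
  assumes y: "(\<Sum>i\<in>UNIV. y $ i) = 0"
    and bound: "\<And>u. u \<in> fixed_space \<sigma> \<Longrightarrow> u \<in> integer_points \<Longrightarrow>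
      4 * (y \<bullet> u) \<le> (\<Sum>i\<in>UNIV. \<Sum>j\<in>UNIV. (u $ i - u $ j)\<^sup>2)"
    and "a \<in> fixed_space \<sigma>"
  shows "4 * (y \<bullet> a) \<le> (\<Sum>i\<in>UNIV. \<Sum>j\<in>UNIV. \<bar>a $ i - a $ j\<bar>)"
  using assms(3)
proof (induction "card (range (($) a))" arbitrary: a rule: less_induct)
  case less
  show ?case
  proof (cases "\<exists>c. \<forall>i. a $ i = c")
    case True
    then obtain c where "\<And>i. a $ i = c"
      by blast
    then show ?thesis
      using y by (simp add: inner_vec_def flip: sum_distrib_right)
  next
    case False
    define m where "m = Max (range (($) a))"
    define m' where "m' = Max (range (($) a) - {m})"
    have m: "a $ i \<le> m" for i
      unfolding m_def by (intro Max_ge) auto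
    have mem_m: "m \<in> range (($) a)"
      unfolding m_def by (intro Max_in) auto
    have ne: "range (($) a) - {m} \<noteq> {}"
      using False by auto
    have m'_in: "m' \<in> range (($) a) - {m}"
      unfolding m'_def using ne by (intro Max_in) auto
    have m': "a $ i \<le> m'" if "a $ i \<noteq> m" for i
      unfolding m'_def using that by (intro Max_ge) auto
    obtain i' where "a $ i' = m'" "m' \<noteq> m"
      using m'_in by auto
    then have "m' < m"
      using m[of i'] by simp
    define s :: "real ^ 'n" where "s = (\<chi> i. if a $ i = m then 1 else 0)"
    define b where "b = a - (m - m') *\<^sub>R s"
    have b: "b $ i = (if a $ i = m then m' else a $ i)" for i
      by (simp add: b_def s_def)
    have fixed: "s \<in> fixed_space \<sigma>" "b \<in> fixed_space \<sigma>"
      using less.prems by (auto simp: fixed_space_def b s_def)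
    have "range (($) b) \<subseteq> range (($) a) - {m}"
      using m'_in \<open>m' < m\<close> by (auto simp: b)
    then have "range (($) b) \<subset> range (($) a)"
      using mem_m by blast
    then have "card (range (($) b)) < card (range (($) a))"
      by (intro psubset_card_mono) auto
    then have IH: "4 * (y \<bullet> b) \<le> (\<Sum>i\<in>UNIV. \<Sum>j\<in>UNIV. \<bar>b $ i - b $ j\<bar>)"
      using fixed(2) by (rule less.hyps)
    have "s \<in> integer_points"
      by (auto simp: integer_points_def s_def)
    then have step: "4 * (y \<bullet> s) \<le> (\<Sum>i\<in>UNIV. \<Sum>j\<in>UNIV. (s $ i - s $ j)\<^sup>2)"
      using fixed(1) by (intro bound)
    \<comment> \<open>Lowering the top level to the next value \<open>m'\<close> keeps the weak
      order of the entries, so absolute differences add without cancellation. For the 0/1 vector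
      \<open>s\<close> squares equal absolute values, which is how the quadratic bound
      enters.\<close>
    have split: "\<bar>a $ i - a $ j\<bar> = \<bar>b $ i - b $ j\<bar> + (m - m') * (s $ i - s $ j)\<^sup>2" for i j
      using m'[of i] m'[of j] \<open>m' < m\<close> by (auto simp: b s_def)
    have "4 * (y \<bullet> a) = 4 * (y \<bullet> b) + (m - m') * (4 * (y \<bullet> s))"
      by (simp add: b_def inner_diff_right algebra_simps)
    also have "\<dots> \<le> (\<Sum>i\<in>UNIV. \<Sum>j\<in>UNIV. \<bar>b $ i - b $ j\<bar>) +
        (m - m') * (\<Sum>i\<in>UNIV. \<Sum>j\<in>UNIV. (s $ i - s $ j)\<^sup>2)"
      using \<open>m' < m\<close> by (intro add_mono IH mult_left_mono step) auto
    also have "\<dots> = (\<Sum>i\<in>UNIV. \<Sum>j\<in>UNIV. \<bar>a $ i - a $ j\<bar>)"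
      by (simp add: split sum.distrib sum_distrib_left)
    finally show ?thesis .
  qed
qed

abbreviation barycenter :: "real ^ 'n" where
  "barycenter \<equiv> (\<chi> i. (real CARD('n) + 1) / 2)"

text \<open>Halfspaces are convex, so the vertices suffice. There \<open>vertex_pairing\<close>
  reduces the claim to single pairs, and integrality of \<open>u\<close> enters: the absolute value
  of an integer is at most its square.\<close>

lemma permutahedron_upper:
  fixes x u :: "real ^ 'n"
  assumes "x \<in> permutahedron" "u \<in> integer_points"
  shows "4 * ((x - barycenter) \<bullet> u) \<le> (\<Sum>i\<in>UNIV. \<Sum>j\<in>UNIV. (u $ i - u $ j)\<^sup>2)"
proof -
  let ?H = "{x. u \<bullet> x \<le> (\<Sum>i\<in>UNIV. \<Sum>j\<in>UNIV. (u $ i - u $ j)\<^sup>2) / 4 + u \<bullet> barycenter}"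
  have "permutahedron \<subseteq> ?H"
    unfolding permutahedron_def
  proof (rule hull_minimal)
    show "convex ?H"
      by (rule convex_halfspace_le)
    show "{(\<chi> i. real (\<pi> i)) |\<pi>. bij_betw \<pi> (UNIV :: 'n set) {1..CARD('n)}} \<subseteq> ?H"
    proof clarify
      fix \<pi> assume \<pi>: "bij_betw \<pi> (UNIV :: 'n set) {1..CARD('n)}"
      have "sgn (real (\<pi> i) - real (\<pi> j)) * (u $ i - u $ j) \<le> (u $ i - u $ j)\<^sup>2" for i j
      proof -
        have "u $ i - u $ j \<in> \<int>"
          using assms(2) by (simp add: integer_points_def)
        then obtain k where k: "u $ i - u $ j = of_int k"
          by (rule Ints_cases)
        have "\<bar>k\<bar> \<le> k\<^sup>2"
          using mult_left_mono[of 1 "\<bar>k\<bar>" "\<bar>k\<bar>"] by (cases "k = 0") (auto simp: power2_eq_square)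
        then have "\<bar>u $ i - u $ j\<bar> \<le> (u $ i - u $ j)\<^sup>2"
          unfolding k by (simp flip: of_int_power of_int_abs)
        moreover have "sgn (real (\<pi> i) - real (\<pi> j)) * (u $ i - u $ j) \<le> \<bar>u $ i - u $ j\<bar>"
          by (auto simp: sgn_if)
        ultimately show ?thesis
          by linarith
      qed
      then have "4 * (\<Sum>i\<in>UNIV. (real (\<pi> i) - (real CARD('n) + 1) / 2) * u $ i) \<le>
          (\<Sum>i\<in>UNIV. \<Sum>j\<in>UNIV. (u $ i - u $ j)\<^sup>2)"
        unfolding vertex_pairing[OF \<pi>] by (intro sum_mono)
      then show "u \<bullet> (\<chi> i. real (\<pi> i)) \<le>
          (\<Sum>i\<in>UNIV. \<Sum>j\<in>UNIV. (u $ i - u $ j)\<^sup>2) / 4 + u \<bullet> barycenter"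
        by (simp add: inner_vec_def right_diff_distrib sum_subtractf mult.commute[of _ "u $ _"])
    qed
  qed
  then have "u \<bullet> x \<le> (\<Sum>i\<in>UNIV. \<Sum>j\<in>UNIV. (u $ i - u $ j)\<^sup>2) / 4 + u \<bullet> barycenter"
    using assms(1) by blast
  then show ?thesis
    by (simp add: inner_diff_right inner_commute[of _ u])
qed

text \<open>The vectors \<open>1\<close> and \<open>- 1\<close> make the right-hand side of
  \<open>permutahedron_upper\<close> zero, which bounds the sum by 0 from both sides.\<close>

lemma permutahedron_sum:
  fixes x :: "real ^ 'n"
  assumes "x \<in> permutahedron"
  shows "(\<Sum>i\<in>UNIV. (x - barycenter) $ i) = 0"
proof -
  have "(1 :: real ^ 'n) \<in> integer_points" "(- 1 :: real ^ 'n) \<in> integer_points"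
    by (auto simp: integer_points_def)
  from permutahedron_upper[OF assms this(1)] permutahedron_upper[OF assms this(2)]
  have "(x - barycenter) \<bullet> 1 = 0"
    by simp
  then show ?thesis
    by (simp add: inner_vec_def)
qed

text \<open>The bound is available for fixed \<open>u\<close> only, so a separating functional has
  to be fixed as well. The direction from the closest point of the permutahedron to the given point
  has this symmetry.\<close>

lemma permutahedron_sliceI:
  fixes y :: "real ^ 'n"
  assumes \<sigma>: "\<sigma> permutes UNIV" and y: "y \<in> slice_space \<sigma>"
    and bound: "\<And>u. u \<in> fixed_space \<sigma> \<Longrightarrow> u \<in> integer_points \<Longrightarrow>
      4 * (y \<bullet> u) \<le> (\<Sum>i\<in>UNIV. \<Sum>j\<in>UNIV. (u $ i - u $ j)\<^sup>2)"
  shows "barycenter + y \<in> permutahedron"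
proof -
  let ?P = "permutahedron :: (real ^ 'n) set"
  define x where "x = barycenter + y"
  have P: "convex ?P" "closed ?P"
    using compact_permutahedron compact_imp_closed by (auto simp: permutahedron_def)
  \<comment> \<open>Any vertex will do here; the constant key imposes no order.\<close>
  obtain \<pi>0 where "bij_betw \<pi>0 (UNIV :: 'n set) {1..CARD('n)}"
    by (rule ex_sorting_bij[of "\<lambda>_. 0 :: nat"])
  then have "?P \<noteq> {}"
    by (auto simp: permutahedron_def)
  define p where "p = closest_point ?P x"
  have p: "p \<in> ?P"
    unfolding p_def by (rule closest_point_in_set) fact+
  have x_fixed: "x \<in> fixed_space \<sigma>"
    using y by (auto simp: x_def slice_space_def fixed_space_def)
  txt \<open>Since \<open>\<sigma>\<close> acts by isometries, the unique closest point to the fixed point \<open>x\<close> is fixed.\<close>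
  have "perm_act \<sigma> p = closest_point ?P x"
  proof (rule closest_point_unique[OF P], safe)
    show "perm_act \<sigma> p \<in> ?P"
      by (rule perm_act_permutahedron) fact+
    fix z assume "z \<in> ?P"
    have "dist x (perm_act \<sigma> p) = norm (perm_act \<sigma> (x - p))"
      using perm_act_fixed_iff[OF \<sigma>, THEN iffD2, OF x_fixed]
      by (simp add: dist_norm linear_diff[OF linear_perm_act])
    also have "\<dots> = dist x p"
      by (simp add: norm_perm_act[OF \<sigma>] dist_norm)
    also have "\<dots> \<le> dist x z"
      unfolding p_def by (rule closest_point_le) fact+
    finally show "dist x (perm_act \<sigma> p) \<le> dist x z" .
  qed
  then have "perm_act \<sigma> p = p"
    by (simp add: p_def)
  define a where "a = x - p"
  have a: "a \<in> fixed_space \<sigma>"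
    using x_fixed \<open>perm_act \<sigma> p = p\<close> perm_act_fixed_iff[OF \<sigma>] subspace_diff[OF subspace_fixed_space]
    by (simp add: a_def)
  \<comment> \<open>The vertex \<open>v\<close> built from \<open>\<pi>\<close> attains the support
    function at \<open>a\<close>, the quantity bounded from below in
    \<open>abs_pairing_bound\<close>.\<close>
  obtain \<pi> where \<pi>: "bij_betw \<pi> (UNIV :: 'n set) {1..CARD('n)}" "\<And>i j. a $ i < a $ j \<Longrightarrow> \<pi> i < \<pi> j"
    using ex_sorting_bij[of "($) a"] by blast
  define v :: "real ^ 'n" where "v = (\<chi> i. real (\<pi> i))"
  have "v \<in> ?P"
    unfolding permutahedron_def v_def using \<pi>(1) by (intro hull_inc) auto
  then have "a \<bullet> (v - p) \<le> 0"
    unfolding a_def p_def by (rule closest_point_dot[OF P])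
  moreover have "4 * (y \<bullet> a) \<le> 4 * ((v - barycenter) \<bullet> a)"
  proof -
    have "4 * (y \<bullet> a) \<le> (\<Sum>i\<in>UNIV. \<Sum>j\<in>UNIV. \<bar>a $ i - a $ j\<bar>)"
      using y bound a by (intro abs_pairing_bound[of y \<sigma>]) (auto simp: slice_space_def)
    also have "\<dots> = (\<Sum>i\<in>UNIV. \<Sum>j\<in>UNIV. sgn (real (\<pi> i) - real (\<pi> j)) * (a $ i - a $ j))"
    proof (intro sum.cong refl)
      fix i j
      show "\<bar>a $ i - a $ j\<bar> = sgn (real (\<pi> i) - real (\<pi> j)) * (a $ i - a $ j)"
        using \<pi>(2)[of i j] \<pi>(2)[of j i] by (cases "a $ i" "a $ j" rule: linorder_cases) auto
    qed
    also have "\<dots> = 4 * ((v - barycenter) \<bullet> a)"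
      unfolding vertex_pairing[OF \<pi>(1), symmetric] by (simp add: v_def inner_vec_def)
    finally show ?thesis .
  qed
  \<comment> \<open>The two inequalities amount to \<open>a \<bullet> x \<le> a \<bullet> v\<close>
    and \<open>a \<bullet> v \<le> a \<bullet> p\<close>, while \<open>a = x - p\<close>.\<close>
  ultimately have "a \<bullet> a \<le> 0"
    by (simp add: a_def x_def inner_diff_left inner_diff_right inner_add_left inner_add_right
        inner_commute algebra_simps)
  then have "a = 0"
    using inner_gt_zero_iff[of a] by linarith
  then show ?thesis
    using p by (simp add: a_def x_def)
qed

section \<open>The slice as a Voronoi cell\<close>

text \<open>\<open>CARD('n)\<close> times the orthogonal projection onto the vectors of sum 0; the
  factor keeps integer vectors integral.\<close>

definition centered :: "real ^ 'n \<Rightarrow> real ^ 'n" where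
  "centered u = real CARD('n) *\<^sub>R u - (\<Sum>i\<in>UNIV. u $ i) *\<^sub>R 1"

text \<open>The lattice Lambda of the overview; \<open>centered_lattice\<close> is its M.\<close>

definition slice_lattice :: "('n::finite \<Rightarrow> 'n) \<Rightarrow> (real ^ 'n) set" where
  "slice_lattice \<sigma> = slice_space \<sigma> \<inter> integer_points"

definition centered_lattice :: "('n::finite \<Rightarrow> 'n) \<Rightarrow> (real ^ 'n) set" where
  "centered_lattice \<sigma> = centered ` (fixed_space \<sigma> \<inter> integer_points)"

lemma linear_centered: "linear centered"
  by (auto simp: linear_iff centered_def sum.distrib scaleR_add_left algebra_simps
      simp flip: sum_distrib_left)

lemma one_in_fixed_space: "1 \<in> fixed_space \<sigma>"
  by (simp add: fixed_space_def)

lemma centered_in_slice_space: "u \<in> fixed_space \<sigma> \<Longrightarrow> centered u \<in> slice_space \<sigma>"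
  by (auto simp: slice_space_def fixed_space_def centered_def sum_subtractf simp flip: sum_distrib_left)

lemma centered_eq_scaleR:
  fixes x :: "real ^ 'n"
  assumes "x \<in> slice_space \<sigma>"
  shows "centered x = real CARD('n) *\<^sub>R x"
  using assms by (simp add: centered_def slice_space_def)

lemma additive_subgroup_fixed_integer: "additive_subgroup (fixed_space \<sigma> \<inter> integer_points)"
  using additive_subgroup_integer_points subspace_fixed_space[of \<sigma>]
  by (auto simp: additive_subgroup_def subspace_0 subspace_diff)

lemma additive_subgroup_slice_lattice: "additive_subgroup (slice_lattice \<sigma>)"
  using additive_subgroup_integer_points subspace_slice_space[of \<sigma>]
  by (auto simp: additive_subgroup_def slice_lattice_def subspace_0 subspace_diff)

lemma additive_subgroup_centered_lattice: "additive_subgroup (centered_lattice \<sigma>)"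
  unfolding additive_subgroup_def centered_lattice_def
proof (intro conjI ballI)
  let ?F = "fixed_space \<sigma> \<inter> integer_points"
  note F = additive_subgroup_fixed_integer[of \<sigma>]
  show "0 \<in> centered ` ?F"
    using additive_subgroup_zero[OF F] linear_0[OF linear_centered] by (auto intro!: image_eqI[of _ _ 0])
  fix x y assume "x \<in> centered ` ?F" "y \<in> centered ` ?F"
  then obtain u v where "u \<in> ?F" "v \<in> ?F" "x = centered u" "y = centered v"
    by blast
  then show "x - y \<in> centered ` ?F"
    using additive_subgroup_diff[OF F, of u v] by (simp flip: linear_diff[OF linear_centered])
qed

lemma centered_lattice_subset: "centered_lattice \<sigma> \<subseteq> slice_lattice \<sigma>"
proof
  fix x assume "x \<in> centered_lattice \<sigma>"
  then obtain u where u: "u \<in> fixed_space \<sigma>" "u \<in> integer_points" "x = centered u"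
    by (auto simp: centered_lattice_def)
  then have "x \<in> integer_points"
    by (auto simp: integer_points_def centered_def intro!: Ints_diff Ints_mult Ints_sum)
  then show "x \<in> slice_lattice \<sigma>"
    using u centered_in_slice_space by (auto simp: slice_lattice_def)
qed

lemma scaleR_slice_lattice_subset:
  fixes \<sigma> :: "'n::finite \<Rightarrow> 'n"
  shows "(*\<^sub>R) (real CARD('n)) ` slice_lattice \<sigma> \<subseteq> centered_lattice \<sigma>"
proof
  fix x assume "x \<in> (*\<^sub>R) (real CARD('n)) ` slice_lattice \<sigma>"
  then obtain y where "x = real CARD('n) *\<^sub>R y" "y \<in> slice_space \<sigma>" "y \<in> integer_points"
    by (auto simp: slice_lattice_def)
  then have "x = centered y" "y \<in> fixed_space \<sigma> \<inter> integer_points"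
    by (auto simp: centered_eq_scaleR slice_space_def)
  then show "x \<in> centered_lattice \<sigma>"
    by (simp add: centered_lattice_def)
qed

definition set_vec :: "'n set \<Rightarrow> real ^ 'n" where
  "set_vec S = (\<chi> i. indicator S i)"

lemma set_vec_nth [simp]: "set_vec S $ i = indicator S i"
  by (simp add: set_vec_def)

lemma sum_set_vec: "(\<Sum>i\<in>UNIV. indicator S i) = real (card S)" for S :: "'n::finite set"
  by (simp add: indicator_def sum.If_cases)

text \<open>The variance identity. With \<open>n = CARD('n)\<close> and \<open>u\<close> read as a
  vector, the right-hand side is \<open>2 / n\<close> times the squared norm of
  \<open>centered u\<close>.\<close>

lemma sum_sq_diff:
  fixes u :: "'n::finite \<Rightarrow> real"
  shows "(\<Sum>i\<in>UNIV. \<Sum>j\<in>UNIV. (u i - u j)\<^sup>2) =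
    2 * (real CARD('n) * (\<Sum>i\<in>UNIV. u i * u i) - (\<Sum>i\<in>UNIV. u i) * (\<Sum>i\<in>UNIV. u i))"
proof -
  have "(\<Sum>i\<in>UNIV. \<Sum>j\<in>UNIV. (u i - u j)\<^sup>2) =
      (\<Sum>i\<in>UNIV. \<Sum>j\<in>UNIV. u i * u i + u j * u j - 2 * (u i * u j))"
    by (intro sum.cong refl) (simp add: power2_eq_square algebra_simps)
  then show ?thesis
    by (simp add: sum.distrib sum_subtractf sum_product flip: sum_distrib_left)
qed

section \<open>Cycles, fixed vectors and their lattices\<close>

context
  fixes \<sigma> :: "'n::finite \<Rightarrow> 'n"
  assumes \<sigma>: "\<sigma> permutes UNIV"
begin

lemma self_in_orbit: "i \<in> orbit \<sigma> i"
  using \<sigma> by (intro permutation_self_in_orbit) (auto simp: permutation_permutes)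

lemma orbit_eq: "j \<in> orbit \<sigma> i \<Longrightarrow> orbit \<sigma> j = orbit \<sigma> i"
  using orbit_cyclic_eq3[OF cyclic_on_orbit[OF \<sigma>]] by simp

lemma mem_orbit_iff: "j \<in> orbit \<sigma> i \<longleftrightarrow> orbit \<sigma> j = orbit \<sigma> i"
  using orbit_eq self_in_orbit by metis

lemma orbit_step_eq: "orbit \<sigma> (\<sigma> i) = orbit \<sigma> i"
  by (rule orbit_eq) (rule orbit.base)

lemma set_vec_in_fixed_space:
  assumes "S \<in> range (orbit \<sigma>)"
  shows "set_vec S \<in> fixed_space \<sigma> \<inter> integer_points"
proof -
  have "\<sigma> i \<in> S \<longleftrightarrow> i \<in> S" for i
    using assms by (auto simp: mem_orbit_iff orbit_step_eq)
  then show ?thesis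
    by (auto simp: fixed_space_def integer_points_def indicator_def)
qed

lemma fixed_space_constant:
  assumes "x \<in> fixed_space \<sigma>" "j \<in> orbit \<sigma> i"
  shows "x $ j = x $ i"
  using assms(2) by induction (use assms(1) in \<open>auto simp: fixed_space_def\<close>)

lemma sum_indicator_cycles: "(\<Sum>S\<in>range (orbit \<sigma>). f S * indicator S i) = (f (orbit \<sigma> i) :: real)"
proof -
  have "(\<Sum>S\<in>range (orbit \<sigma>). f S * indicator S i) =
      (\<Sum>S\<in>range (orbit \<sigma>). if S = orbit \<sigma> i then f (orbit \<sigma> i) else 0)"
    by (intro sum.cong) (auto simp: indicator_def mem_orbit_iff)
  then show ?thesis
    by simp
qed

lemma fixed_space_expansion:
  assumes "x \<in> fixed_space \<sigma>"
  shows "x = (\<Sum>S\<in>range (orbit \<sigma>). (x $ (SOME i. i \<in> S)) *\<^sub>R set_vec S)"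
proof -
  have "x $ (SOME j. j \<in> orbit \<sigma> i) = x $ i" for i
    using assms someI[of "\<lambda>j. j \<in> orbit \<sigma> i", OF self_in_orbit] by (rule fixed_space_constant)
  then show ?thesis
    by (simp add: vec_eq_iff sum_indicator_cycles)
qed

lemma span_set_vec_cycles: "span (set_vec ` range (orbit \<sigma>)) = fixed_space \<sigma>"
proof
  show "span (set_vec ` range (orbit \<sigma>)) \<subseteq> fixed_space \<sigma>"
    using set_vec_in_fixed_space by (intro span_minimal subspace_fixed_space) blast
  show "fixed_space \<sigma> \<subseteq> span (set_vec ` range (orbit \<sigma>))"
  proof
    fix x assume "x \<in> fixed_space \<sigma>"
    then have "x = (\<Sum>S\<in>range (orbit \<sigma>). (x $ (SOME i. i \<in> S)) *\<^sub>R set_vec S)"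
      by (rule fixed_space_expansion)
    also have "\<dots> \<in> span (set_vec ` range (orbit \<sigma>))"
      by (intro span_sum span_scale span_base) auto
    finally show "x \<in> span (set_vec ` range (orbit \<sigma>))" .
  qed
qed

lemma dim_fixed_space: "dim (fixed_space \<sigma>) = card (range (orbit \<sigma>))"
proof -
  have inj: "inj_on set_vec (range (orbit \<sigma>))"
    by (rule inj_on_inverseI[of _ "\<lambda>x. {i. x $ i = 1}"]) (auto simp: indicator_def split: if_splits)
  have "pairwise orthogonal (set_vec ` range (orbit \<sigma>))"
  proof (rule pairwise_imageI)
    fix S T assume "S \<in> range (orbit \<sigma>)" "T \<in> range (orbit \<sigma>)" "S \<noteq> T"
    then have "indicator S i * indicator T i = (0 :: real)" for i
      by (auto simp: indicator_def mem_orbit_iff)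
    then show "orthogonal (set_vec S) (set_vec T)"
      by (simp only: orthogonal_def inner_vec_def set_vec_nth inner_real_def sum.neutral_const)
  qed
  moreover have "0 \<notin> set_vec ` range (orbit \<sigma>)"
  proof
    assume "0 \<in> set_vec ` range (orbit \<sigma>)"
    then obtain i where "set_vec (orbit \<sigma> i) = 0"
      by auto
    then have "set_vec (orbit \<sigma> i) $ i = 0"
      by simp
    then show False
      using self_in_orbit by (simp add: indicator_def)
  qed
  ultimately have "independent (set_vec ` range (orbit \<sigma>))"
    by (rule pairwise_orthogonal_independent)
  then have "dim (set_vec ` range (orbit \<sigma>)) = card (range (orbit \<sigma>))"
    using inj by (simp add: dim_eq_card_independent card_image)
  then show ?thesis
    by (simp flip: span_set_vec_cycles)
qed

text \<open>The vector \<open>1\<close> complements \<open>slice_space \<sigma>\<close> in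
  \<open>fixed_space \<sigma>\<close>, because \<open>CARD('n)\<close> times \<open>x\<close> is
  \<open>centered x\<close> plus a multiple of \<open>1\<close>.\<close>

lemma dim_slice_space: "dim (slice_space \<sigma>) + 1 = card (range (orbit \<sigma>))"
proof -
  have span: "span (slice_space \<sigma>) = slice_space \<sigma>"
    by (rule span_eq_iff[THEN iffD2]) (rule subspace_slice_space)
  have "1 \<notin> slice_space \<sigma>"
    by (simp add: slice_space_def)
  then have "dim (insert 1 (slice_space \<sigma>)) = dim (slice_space \<sigma>) + 1"
    by (simp add: dim_insert span)
  moreover have "span (insert 1 (slice_space \<sigma>)) = fixed_space \<sigma>"
  proof
    show "span (insert 1 (slice_space \<sigma>)) \<subseteq> fixed_space \<sigma>"
      using one_in_fixed_space by (intro span_minimal subspace_fixed_space) (auto simp: slice_space_def)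
    show "fixed_space \<sigma> \<subseteq> span (insert 1 (slice_space \<sigma>))"
    proof
      fix x assume "x \<in> fixed_space \<sigma>"
      then have "centered x \<in> slice_space \<sigma>"
        by (rule centered_in_slice_space)
      then have "(1 / real CARD('n)) *\<^sub>R (centered x + (\<Sum>i\<in>UNIV. x $ i) *\<^sub>R 1) \<in>
          span (insert 1 (slice_space \<sigma>))"
        by (intro span_scale span_add) (auto intro: span_base)
      then show "x \<in> span (insert 1 (slice_space \<sigma>))"
        by (simp add: centered_def)
    qed
  qed
  ultimately show ?thesis
    by (metis dim_fixed_space dim_span)
qed

lemma slice_space_subset_span: "slice_space \<sigma> \<subseteq> span (centered_lattice \<sigma>)"
proof
  fix x assume x: "x \<in> slice_space \<sigma>"
  then have "centered x \<in> centered ` span (set_vec ` range (orbit \<sigma>))"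
    unfolding span_set_vec_cycles by (auto simp: slice_space_def)
  also have "\<dots> = span (centered ` set_vec ` range (orbit \<sigma>))"
    by (rule linear_span_image[OF linear_centered, symmetric])
  also have "\<dots> \<subseteq> span (centered_lattice \<sigma>)"
    using set_vec_in_fixed_space by (intro span_mono) (auto simp: centered_lattice_def)
  finally have "(1 / real CARD('n)) *\<^sub>R (real CARD('n) *\<^sub>R x) \<in> span (centered_lattice \<sigma>)"
    unfolding centered_eq_scaleR[OF x] by (rule span_scale)
  then show "x \<in> span (centered_lattice \<sigma>)"
    unfolding scaleR_scaleR by simp
qed

lemma
  shows span_centered_lattice: "span (centered_lattice \<sigma>) = slice_space \<sigma>"
    and span_slice_lattice: "span (slice_lattice \<sigma>) = slice_space \<sigma>"
    and span_scaleR_slice_lattice: "span ((*\<^sub>R) (real CARD('n)) ` slice_lattice \<sigma>) = slice_space \<sigma>"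
proof -
  have sub: "span (slice_lattice \<sigma>) \<subseteq> slice_space \<sigma>"
    by (intro span_minimal subspace_slice_space) (auto simp: slice_lattice_def)
  have "span (centered_lattice \<sigma>) \<subseteq> span (slice_lattice \<sigma>)"
    by (intro span_mono centered_lattice_subset)
  then show *: "span (centered_lattice \<sigma>) = slice_space \<sigma>" "span (slice_lattice \<sigma>) = slice_space \<sigma>"
    using sub slice_space_subset_span by auto
  have "span ((*\<^sub>R) (real CARD('n)) ` slice_lattice \<sigma>) = (*\<^sub>R) (real CARD('n)) ` slice_space \<sigma>"
    unfolding *(2)[symmetric] by (rule linear_span_image) (rule linear_scaleR)
  also have "\<dots> = slice_space \<sigma>"
  proof (intro equalityI subsetI)
    fix x assume "x \<in> slice_space \<sigma>"
    then have "(1 / real CARD('n)) *\<^sub>R x \<in> slice_space \<sigma>"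
      by (rule subspace_scale[OF subspace_slice_space])
    then show "x \<in> (*\<^sub>R) (real CARD('n)) ` slice_space \<sigma>"
      by (rule rev_image_eqI) simp
  qed (auto intro: subspace_scale[OF subspace_slice_space])
  finally show "span ((*\<^sub>R) (real CARD('n)) ` slice_lattice \<sigma>) = slice_space \<sigma>" .
qed

text \<open>For \<open>y\<close> of sum 0 the product \<open>y \<bullet> centered u\<close> is
  \<open>n\<close> times \<open>y \<bullet> u\<close>, and by \<open>sum_sq_diff\<close> the squared
  norm of \<open>centered u\<close> is \<open>n / 2\<close> times the sum of squared differences.
  Cancelling \<open>n\<close> turns the Voronoi inequality into that of
  \<open>permutahedron_upper\<close>.\<close>

lemma mem_voronoi_cell_centered_lattice_iff:
  "y \<in> voronoi_cell (centered_lattice \<sigma>) \<longleftrightarrow> y \<in> slice_space \<sigma> \<and>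
    (\<forall>u \<in> fixed_space \<sigma> \<inter> integer_points. 4 * (y \<bullet> u) \<le> (\<Sum>i\<in>UNIV. \<Sum>j\<in>UNIV. (u $ i - u $ j)\<^sup>2))"
proof -
  have "norm y \<le> norm (y - centered u) \<longleftrightarrow> 4 * (y \<bullet> u) \<le> (\<Sum>i\<in>UNIV. \<Sum>j\<in>UNIV. (u $ i - u $ j)\<^sup>2)"
    if y: "y \<in> slice_space \<sigma>" for u
  proof -
    define n s where "n = real CARD('n)" and "s = (\<Sum>i\<in>UNIV. u $ i)"
    have "n > 0"
      by (simp add: n_def)
    have one: "1 \<bullet> v = (\<Sum>i\<in>UNIV. v $ i)" for v :: "real ^ 'n"
      by (simp add: inner_vec_def)
    have c: "centered u = n *\<^sub>R u - s *\<^sub>R 1"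
      by (simp add: centered_def n_def s_def)
    have yc: "y \<bullet> centered u = n * (y \<bullet> u)"
      using y by (simp add: c inner_diff_right slice_space_def one inner_commute[of y 1])
    have cc: "centered u \<bullet> centered u = n * (n * (u \<bullet> u) - s * s)"
      unfolding c by (simp add: inner_diff_left inner_diff_right one inner_commute[of u 1] algebra_simps
          flip: n_def s_def)
    have uu: "(\<Sum>i\<in>UNIV. \<Sum>j\<in>UNIV. (u $ i - u $ j)\<^sup>2) = 2 * (n * (u \<bullet> u) - s * s)"
      unfolding sum_sq_diff by (simp add: n_def s_def inner_vec_def)
    have "norm y \<le> norm (y - centered u) \<longleftrightarrow> n * (2 * (y \<bullet> u)) \<le> n * (n * (u \<bullet> u) - s * s)"
      by (simp only: norm_le_norm_diff_iff yc cc mult.left_commute[of 2 n])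
    also have "\<dots> \<longleftrightarrow> 2 * (y \<bullet> u) \<le> n * (u \<bullet> u) - s * s"
      by (rule mult_le_cancel_left_pos[OF \<open>n > 0\<close>])
    also have "\<dots> \<longleftrightarrow> 4 * (y \<bullet> u) \<le> 2 * (n * (u \<bullet> u) - s * s)"
      by auto
    finally show ?thesis
      by (simp only: uu)
  qed
  then show ?thesis
    unfolding voronoi_cell_def span_centered_lattice by (auto simp: centered_lattice_def)
qed

lemma permutahedron_slice_eq_voronoi:
  "permutahedron_slice \<sigma> = (+) barycenter ` voronoi_cell (centered_lattice \<sigma>)"
proof (intro equalityI subsetI)
  fix x assume "x \<in> permutahedron_slice \<sigma>"
  then have x: "x \<in> permutahedron" "x \<in> fixed_space \<sigma>"
    using perm_act_fixed_iff[OF \<sigma>] by (auto simp: permutahedron_slice_def)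
  have "x - barycenter \<in> slice_space \<sigma>"
    using x(2) permutahedron_sum[OF x(1)] by (auto simp: slice_space_def fixed_space_def)
  then have "x - barycenter \<in> voronoi_cell (centered_lattice \<sigma>)"
    using permutahedron_upper[OF x(1)] by (simp add: mem_voronoi_cell_centered_lattice_iff)
  then show "x \<in> (+) barycenter ` voronoi_cell (centered_lattice \<sigma>)"
    by (rule rev_image_eqI) simp
next
  fix x assume "x \<in> (+) barycenter ` voronoi_cell (centered_lattice \<sigma>)"
  then obtain y where x: "x = barycenter + y" and y: "y \<in> voronoi_cell (centered_lattice \<sigma>)"
    by blast
  then have "x \<in> permutahedron"
    using permutahedron_sliceI[OF \<sigma>, of y] by (simp add: mem_voronoi_cell_centered_lattice_iff)
  moreover have "x \<in> fixed_space \<sigma>"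
    using x y by (auto simp: mem_voronoi_cell_centered_lattice_iff slice_space_def fixed_space_def)
  ultimately show "x \<in> permutahedron_slice \<sigma>"
    using perm_act_fixed_iff[OF \<sigma>] by (simp add: permutahedron_slice_def)
qed

text \<open>A fixed integer vector is constant on cycles, so its sum is an integer combination of
  cycle lengths.\<close>

lemma sum_fixed_integer_dvd:
  assumes "u \<in> fixed_space \<sigma>" "u \<in> integer_points"
  obtains s where "(\<Sum>i\<in>UNIV. u $ i) = real (Gcd (card ` range (orbit \<sigma>))) * of_int s"
proof -
  let ?C = "range (orbit \<sigma>)"
  let ?g = "Gcd (card ` ?C)"
  define f where "f S = \<lfloor>u $ (SOME i. i \<in> S)\<rfloor>" for S
  have f: "u $ (SOME i. i \<in> S) = of_int (f S)" for S
    using assms(2) by (auto simp: f_def integer_points_def elim!: Ints_cases)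
  have "(\<Sum>i\<in>UNIV. u $ i) = (\<Sum>i\<in>UNIV. (\<Sum>S\<in>?C. of_int (f S) *\<^sub>R set_vec S) $ i)"
    using fixed_space_expansion[OF assms(1)] by (simp add: f)
  also have "\<dots> = (\<Sum>S\<in>?C. \<Sum>i\<in>UNIV. of_int (f S) * indicator S i)"
    by (simp only: sum_component vector_scaleR_component set_vec_nth real_scaleR_def) (rule sum.swap)
  also have "\<dots> = (\<Sum>S\<in>?C. of_int (f S) * real (card S))"
    by (simp flip: sum_distrib_left add: sum_set_vec)
  also have "\<dots> = (\<Sum>S\<in>?C. of_int (f S) * (real ?g * real (card S div ?g)))"
    by (intro sum.cong refl) (simp add: Gcd_dvd flip: of_nat_mult)
  also have "\<dots> = real ?g * of_int (\<Sum>S\<in>?C. f S * int (card S div ?g))"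
    by (simp add: sum_distrib_left mult_ac)
  finally show ?thesis
    by (rule that)
qed

text \<open>Bezout: the sums of fixed integer vectors form a subgroup of the integers, and it
  contains every cycle length as the sum of an indicator vector.\<close>

lemma ex_fixed_integer_sum_eq_Gcd:
  obtains u where "u \<in> fixed_space \<sigma>" "u \<in> integer_points"
    "(\<Sum>i\<in>UNIV. u $ i) = real (Gcd (card ` range (orbit \<sigma>)))"
proof -
  let ?F = "fixed_space \<sigma> \<inter> integer_points"
  note F = additive_subgroup_fixed_integer[of \<sigma>]
  define A where "A = {k::int. \<exists>u\<in>?F. (\<Sum>i\<in>UNIV. u $ i) = of_int k}"
  have "additive_subgroup A"
    unfolding additive_subgroup_def
  proof (intro conjI ballI)
    show "0 \<in> A"
      using additive_subgroup_zero[OF F] unfolding A_def by (intro CollectI bexI[of _ 0]) auto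
    fix k l assume "k \<in> A" "l \<in> A"
    then obtain u v where "u \<in> ?F" "v \<in> ?F" "(\<Sum>i\<in>UNIV. u $ i) = of_int k" "(\<Sum>i\<in>UNIV. v $ i) = of_int l"
      unfolding A_def by blast
    then show "k - l \<in> A"
      using additive_subgroup_diff[OF F, of u v] unfolding A_def
      by (intro CollectI bexI[of _ "u - v"]) (simp_all add: sum_subtractf)
  qed
  moreover have "int ` card ` range (orbit \<sigma>) \<subseteq> A"
  proof clarify
    fix i
    show "int (card (orbit \<sigma> i)) \<in> A"
      using set_vec_in_fixed_space[of "orbit \<sigma> i"] unfolding A_def
      by (intro CollectI bexI[of _ "set_vec (orbit \<sigma> i)"]) (auto simp: sum_set_vec)
  qed
  ultimately have "group_closure (int ` card ` range (orbit \<sigma>)) \<subseteq> A"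
    by (rule group_closure_subset)
  then have "Gcd (int ` card ` range (orbit \<sigma>)) \<in> A"
    using Gcd_in_group_closure by blast
  then have "int (Gcd (card ` range (orbit \<sigma>))) \<in> A"
    by simp
  then show ?thesis
    using that unfolding A_def by auto
qed

end

text \<open>The quotient is cyclic of order \<open>k = n / g\<close>, generated by
  \<open>centered x\<close> for a fixed integer vector \<open>x\<close> of sum \<open>g\<close>; the
  multiples by \<open>0\<close>, ..., \<open>k - 1\<close> are the representatives.\<close>

lemma centered_lattice_transversal:
  fixes \<sigma> :: "'n::finite \<Rightarrow> 'n"
  assumes \<sigma>: "\<sigma> permutes UNIV"
  defines "g \<equiv> Gcd (card ` range (orbit \<sigma>))" and "N \<equiv> (*\<^sub>R) (real CARD('n)) ` slice_lattice \<sigma>"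
  obtains R where "finite R" "card R * g = CARD('n)" "R \<subseteq> centered_lattice \<sigma>"
    "\<And>v. v \<in> centered_lattice \<sigma> \<Longrightarrow> \<exists>r\<in>R. v - r \<in> N"
    "\<And>r r'. r \<in> R \<Longrightarrow> r' \<in> R \<Longrightarrow> r - r' \<in> N \<Longrightarrow> r = r'"
proof -
  let ?n = "CARD('n)"
  have one: "(1 :: real ^ 'n) \<in> integer_points" "(1 :: real ^ 'n) \<in> fixed_space \<sigma>"
    by (auto simp: integer_points_def one_in_fixed_space)
  \<comment> \<open>The vector \<open>1\<close> has sum \<open>?n\<close>, so \<open>g\<close>
    divides \<open>?n\<close>.\<close>
  obtain s where "(\<Sum>i\<in>UNIV. (1 :: real ^ 'n) $ i) = real g * of_int s"
    unfolding g_def using sum_fixed_integer_dvd[OF \<sigma> one(2,1)] by blast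
  then have "real_of_int (int ?n) = real_of_int (int g * s)"
    by simp
  then have "int ?n = int g * s"
    by (simp only: of_int_eq_iff)
  then have "g dvd ?n"
    by (metis dvd_triv_left of_nat_dvd_iff)
  then obtain k where k: "?n = g * k"
    by blast
  then have pos: "g > 0" "k > 0"
    by (auto intro: gr0I)
  obtain x where x: "x \<in> fixed_space \<sigma>" "x \<in> integer_points" "(\<Sum>i\<in>UNIV. x $ i) = real g"
    unfolding g_def using ex_fixed_integer_sum_eq_Gcd[OF \<sigma>] by blast
  define c where "c = centered x"
  have c_in: "c \<in> centered_lattice \<sigma>"
    using x by (auto simp: c_def centered_lattice_def)
  \<comment> \<open>A single coordinate decides: comparing entries gives
    \<open>z * (k * a - 1) = k * b\<close>, and \<open>k * a - 1\<close> is -1 modulo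
    \<open>k\<close>.\<close>
  have dvd: "int k dvd z" if "of_int z *\<^sub>R c \<in> N" for z
  proof -
    from that obtain y where y: "y \<in> integer_points" "of_int z *\<^sub>R c = real ?n *\<^sub>R y"
      by (auto simp: N_def slice_lattice_def)
    fix i
    obtain a b where ab: "x $ i = of_int a" "y $ i = of_int b"
      using x(2) y(1) by (fastforce simp: integer_points_def elim: Ints_cases)
    have "(of_int z *\<^sub>R c) $ i = (real ?n *\<^sub>R y) $ i"
      by (simp only: y(2))
    then have "real_of_int (z * (int ?n * a - int g)) = real_of_int (int ?n * b)"
      by (simp add: c_def centered_def x(3) ab)
    then have "z * (int ?n * a - int g) = int ?n * b"
      by (simp only: of_int_eq_iff)
    then have "int g * (z * (int k * a - 1)) = int g * (int k * b)"
      by (simp add: k algebra_simps)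
    then have "z * (int k * a - 1) = int k * b"
      using pos by (simp only: mult_cancel_left) simp
    then have "z = int k * (z * a - b)"
      by (simp add: algebra_simps)
    then show ?thesis
      by (metis dvd_triv_left)
  qed
  define r where "r j = of_int (int j) *\<^sub>R c" for j
  have r_diff: "r i - r j = of_int (int i - int j) *\<^sub>R c" for i j
    by (simp add: r_def scaleR_diff_left)
  have r_distinct: "i = j" if "i < k" "j < k" "r i - r j \<in> N" for i j
  proof -
    have "int k dvd int i - int j"
      using dvd that(3) unfolding r_diff by blast
    then have "int i mod int k = int j mod int k"
      by (simp add: mod_eq_dvd_iff)
    then show ?thesis
      using that by simp
  qed
  have "0 \<in> N"
    unfolding N_def by (rule additive_subgroup_zero[OF additive_subgroup_scaleR_image[OF additive_subgroup_slice_lattice]])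
  then have "inj_on r {..<k}"
    using r_distinct by (intro inj_onI) simp
  show ?thesis
  proof (rule that[of "r ` {..<k}"])
    show "card (r ` {..<k}) * g = ?n"
      using \<open>inj_on r {..<k}\<close> by (simp add: card_image k)
    show "r ` {..<k} \<subseteq> centered_lattice \<sigma>"
      unfolding r_def using c_in additive_subgroup_centered_lattice additive_subgroup_scaleR_int by blast
  next
    fix v assume "v \<in> centered_lattice \<sigma>"
    then obtain u where u: "u \<in> fixed_space \<sigma>" "u \<in> integer_points" "v = centered u"
      by (auto simp: centered_lattice_def)
    obtain s where s: "(\<Sum>i\<in>UNIV. u $ i) = real g * of_int s"
      unfolding g_def using sum_fixed_integer_dvd[OF \<sigma> u(1,2)] by blast
    define q j where "q = s div int k" and "j = nat (s mod int k)"
    have j: "j < k" "int j = s mod int k"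
      using pos by (auto simp: j_def nat_less_iff)
    have "s = int k * q + int j"
      by (simp add: j q_def)
    then have sqj: "real_of_int s = real k * of_int q + real j"
      by (metis of_int_add of_int_mult of_int_of_nat_eq)
    \<comment> \<open>Subtracting these multiples of \<open>x\<close> and \<open>1\<close> brings
      the sum to 0, where \<open>centered\<close> is multiplication by \<open>?n\<close>. The
      multiple of \<open>1\<close> leaves the class unchanged because
      \<open>centered 1 = 0\<close>.\<close>
    define w where "w = u - of_int (int j) *\<^sub>R x - of_int q *\<^sub>R 1"
    have w: "w \<in> fixed_space \<sigma> \<inter> integer_points"
      unfolding w_def using u x one
      by (intro additive_subgroup_diff additive_subgroup_scaleR_int additive_subgroup_fixed_integer) auto
    have "(\<Sum>i\<in>UNIV. w $ i) = (\<Sum>i\<in>UNIV. u $ i) - real j * (\<Sum>i\<in>UNIV. x $ i) - of_int q * real ?n"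
      by (simp add: w_def sum_subtractf flip: sum_distrib_left)
    also have "\<dots> = 0"
      by (simp add: s x(3) sqj k algebra_simps)
    finally have w0: "(\<Sum>i\<in>UNIV. w $ i) = 0" .
    have "centered 1 = (0 :: real ^ 'n)"
      by (simp add: centered_def)
    then have "centered w = v - r j"
      by (simp add: w_def u(3) r_def c_def linear_diff[OF linear_centered] linear_scale[OF linear_centered])
    moreover have "centered w = real ?n *\<^sub>R w" "w \<in> slice_lattice \<sigma>"
      using w w0 by (simp_all add: centered_def slice_lattice_def slice_space_def)
    ultimately have "v - r j \<in> N"
      unfolding N_def by (metis imageI)
    then show "\<exists>r\<in>r ` {..<k}. v - r \<in> N"
      using j by blast
  next
    fix r1 r2 assume "r1 \<in> r ` {..<k}" "r2 \<in> r ` {..<k}" "r1 - r2 \<in> N"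
    then show "r1 = r2"
      using r_distinct by auto
  qed simp
qed

section \<open>The volume of the slice from the two tilings\<close>

theorem theorem1p2:
  fixes \<sigma> :: "'n::finite \<Rightarrow> 'n" and l :: "nat list"
  assumes "\<sigma> permutes UNIV"
    and "mset l = cycle_lengths \<sigma>"
  shows "normalized_volume (permutahedron_slice \<sigma>) =
    real CARD('n) powi (int (length l) - 2) * real (Gcd (set l))"
proof -
  let ?n = "real CARD('n)"
  let ?E = "slice_space \<sigma>"
  let ?M = "centered_lattice \<sigma>"
  let ?N = "(*\<^sub>R) ?n ` slice_lattice \<sigma>"
  let ?W = "voronoi_cell ?M"
  define g where "g = Gcd (card ` range (orbit \<sigma>))"
  \<comment> \<open>The gcd sees only the set of lengths, while \<open>length l\<close> counts all
    cycles, including those of equal length.\<close>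
  have "set_mset (mset l) = card ` range (orbit \<sigma>)" "size (mset l) = card (range (orbit \<sigma>))"
    by (simp_all add: assms(2) cycle_lengths_def)
  then have l: "Gcd (set l) = g" "length l = card (range (orbit \<sigma>))"
    by (simp_all add: g_def)
  note span_M = span_centered_lattice[OF assms(1)]
  have E: "subspace ?E"
    by (rule subspace_slice_space)
  have "?M \<subseteq> integer_points"
    using centered_lattice_subset by (auto simp: slice_lattice_def)
  then have discrete: "v = 0" if "v \<in> ?M" "norm v < 1" for v
    using integer_points_discrete that by blast
  have countable: "countable ?M"
    using \<open>?M \<subseteq> integer_points\<close> countable_integer_points by (rule countable_subset)
  have W: "tiles ?W ?M"
    by (rule tiles_voronoi_cell[OF additive_subgroup_centered_lattice zero_less_one discrete])
  have span_W: "span ?W = ?E"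
    using span_voronoi_cell[OF zero_less_one discrete, where M = ?M] span_M by simp
  have "0 \<in> ?W"
    by (simp add: voronoi_cell_def span_zero)
  \<comment> \<open>The basis that \<open>euclidean_volume\<close> picks both for the slice and for
    the parallelotope, so that one measure serves both.\<close>
  define B where "B = (SOME B. orthonormal_basis_of ?E B)"
  have ob: "orthonormal_basis_of ?E B"
    unfolding B_def using ex_orthonormal_basis_of[OF E] by (rule someI_ex)
  then have "independent B"
    by (rule orthonormal_basis_of_independent)
  then have B: "finite B" "card B = dim ?E"
    using independent_imp_finite dim_eq_card_independent[of B] dim_span[of B] ob
    by (auto simp del: dim_span simp: orthonormal_basis_of_def)
  let ?\<nu> = "measure (span_measure B)"
  have vol_W: "euclidean_volume (permutahedron_slice \<sigma>) = ?\<nu> ?W"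
    unfolding permutahedron_slice_eq_voronoi[OF assms(1)] B_def
    by (rule euclidean_volume_translate[OF E _ \<open>0 \<in> ?W\<close> span_W refl])
      (use W in \<open>simp add: tiles_def\<close>)
  have hull: "affine hull (permutahedron_slice \<sigma>) = (+) barycenter ` ?E"
    unfolding permutahedron_slice_eq_voronoi[OF assms(1)]
    by (simp add: affine_hull_translate_span \<open>0 \<in> ?W\<close> span_W)
  define Q where "Q = (SOME Q. primitive_parallelotope (affine hull (permutahedron_slice \<sigma>)) Q)"
  have "primitive_parallelotope ((+) barycenter ` ?E) Q"
    unfolding Q_def hull using E span_slice_lattice[OF assms(1)]
    by (intro someI_ex[OF ex_primitive_parallelotope]) (simp_all add: slice_lattice_def)
  then obtain p C where C: "independent C" "group_closure C = slice_lattice \<sigma>"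
    and p: "(+) p ` ?E = (+) barycenter ` ?E" and Q: "Q = (+) p ` parallelotope C"
    using E unfolding slice_lattice_def by (rule primitive_parallelotope_translateE)
  let ?P = "parallelotope C"
  have "finite C"
    using C(1) by (rule independent_imp_finite)
  have span_C: "span ?P = ?E"
    using span_slice_lattice[OF assms(1)]
    by (simp add: span_parallelotope[OF \<open>finite C\<close>] flip: C(2) span_group_closure[of C])
  have P: "tiles ?P (slice_lattice \<sigma>)"
    using tiles_parallelotope[OF C(1)] by (simp add: C(2))
  then have "compact ?P"
    by (simp add: tiles_def)
  have vol_Q: "euclidean_volume Q = ?\<nu> ?P"
    unfolding Q B_def
    by (rule euclidean_volume_translate[OF E \<open>compact ?P\<close> zero_in_parallelotope span_C refl])
  have nP: "tiles ((*\<^sub>R) ?n ` ?P) ?N"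
    by (rule tiles_scaleR[OF P]) simp
  obtain R where R: "finite R" "card R * g = CARD('n)" "R \<subseteq> ?M"
    "\<And>v. v \<in> ?M \<Longrightarrow> \<exists>r\<in>R. v - r \<in> ?N"
    "\<And>r r'. r \<in> R \<Longrightarrow> r' \<in> R \<Longrightarrow> r - r' \<in> ?N \<Longrightarrow> r = r'"
    using centered_lattice_transversal[OF assms(1), folded g_def] by blast
  have "real (card R) * ?\<nu> ?W = ?\<nu> ((*\<^sub>R) ?n ` ?P)"
  proof (rule tiles_index[where M = ?M and N = ?N])
    show "span ?N = span ?M"
      by (simp add: span_M span_scaleR_slice_lattice[OF assms(1)])
    show "?N \<subseteq> ?M"
      by (rule scaleR_slice_lattice_subset)
    show "additive_subgroup ?N"
      by (rule additive_subgroup_scaleR_image) (rule additive_subgroup_slice_lattice)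
  qed (use ob span_M additive_subgroup_centered_lattice countable W nP R in auto)
  also have "\<dots> = ?n ^ dim ?E * ?\<nu> ?P"
    using measure_span_measure_scaleR[OF B(1), of ?n ?P] \<open>compact ?P\<close> B(2) by (simp add: borel_compact)
  finally have eq: "real (card R) * ?\<nu> ?W = ?n ^ dim ?E * ?\<nu> ?P" .
  have "countable (slice_lattice \<sigma>)"
    by (rule countable_subset[OF _ countable_integer_points]) (auto simp: slice_lattice_def)
  then have pos: "?\<nu> ?P > 0"
    using ob P span_slice_lattice[OF assms(1)]
    by (intro tiles_measure_pos[of "slice_lattice \<sigma>"] additive_subgroup_slice_lattice) simp_all
  have "real (card R * g) = ?n"
    by (simp only: R(2))
  then have n: "?n = real (card R) * real g"
    by simp
  have "?n \<noteq> 0"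
    by simp
  then have nz: "real (card R) \<noteq> 0" "real g \<noteq> 0"
    unfolding n by auto
  have "normalized_volume (permutahedron_slice \<sigma>) = ?\<nu> ?W / ?\<nu> ?P"
    by (simp add: normalized_volume_def vol_W vol_Q flip: Q_def)
  also have "\<dots> = ?n ^ dim ?E / real (card R)"
    using eq pos nz by (simp add: field_simps)
  also have "\<dots> = ?n ^ dim ?E * real g / ?n"
    using nz by (simp add: n)
  \<comment> \<open>\<open>dim ?E\<close> is one less than the number of cycles. It is 0 for a
    single cycle, so the exponent can be -1.\<close>
  also have "\<dots> = ?n powi (int (dim ?E) - 1) * real g"
    by (simp add: power_int_diff)
  also have "int (dim ?E) - 1 = int (length l) - 2"
    using dim_slice_space[OF assms(1)] l(2) by simp
  finally show ?thesis
    by (simp add: l(1))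
qed

end
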